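(* For each integer $N\ge 1$ let $\omega_N\subset\mathbb{S}^2$ be the configuration of $N$ generalized spiral points, i.e. the points with spherical coordinates $(\phi_k,\theta_k)$, $k=1,\dots,N$ ($\phi$ the polar angle, $\theta$ the azimuth), where $$L=\sqrt{N\pi},\qquad h_k=1-\frac{2k-1}{N},\qquad \phi_k=\cos^{-1}(h_k),\qquad \theta_k=L\phi_k .$$ Then the sequence $\{\omega_N\}_{N=1}^\infty$ is equidistributed on $\mathbb{S}^2$, is quasi-uniform, and satisfies $$\lim_{N\to\infty}\sqrt{N}\,\delta(\omega_N)=\sqrt{8-4\sqrt{3}\cos\bigl(\sqrt{2\pi}(1-\sqrt{3})\bigr)}\approx 3.131948\ldots.$$
   Context: $\mathbb{S}^2=\{x\in\mathbb{R}^3:|x|=1\}$ with $|\cdot|$ the Euclidean norm; $\sigma$ is the surface area measure on $\mathbb{S}^2$ normalized so that $\sigma(\mathbb{S}^2)=1$. The point with spherical coordinates $(\phi,\theta)$ is $(\sin\phi\cos\theta,\sin\phi\sin\theta,\cos\phi)$. A sequence of finite configurations $\omega_N\subset\mathbb{S}^2$ with $|\omega_N|=N$ is equidistributed if the normalized counting measures $\nu_N(A)=\frac1N|A\cap\omega_N|$ converge weak-star to $\sigma$, i.e. $\int f\,d\nu_N\to\int f\,d\sigma$ for every continuous $f:\mathbb{S}^2\to\mathbb{R}$. For a configuration $\omega$ with at least two points, the separation is $\delta(\omega)=\min_{x\ne y\in\omega}|x-y|$, the covering radius is $\eta(\omega)=\max_{y\in\mathbb{S}^2}\min_{x\in\omega}|x-y|$,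 and the mesh ratio is $\gamma(\omega)=\eta(\omega)/\delta(\omega)$. A sequence of configurations is quasi-uniform if the sequence of mesh ratios $\gamma(\omega_N)$, $N\ge2$, is bounded. *)

theory Defs
  imports "HOL-Analysis.Analysis"
begin

abbreviation S2 :: "(real ^ 3) set" where
  "S2 \<equiv> sphere 0 1"

definition sph_point :: "real \<Rightarrow> real \<Rightarrow> real ^ 3" where
  "sph_point \<phi> \<theta> = vector [sin \<phi> * cos \<theta>, sin \<phi> * sin \<theta>, cos \<phi>]"

text \<open>
  Surface area on the sphere: the image under the spherical coordinate parametrization of the
  area element (the norm of the cross product of the two partial derivatives). The parameter
  rectangle covers the sphere once up to a null set.
\<close>

definition area_S2 :: "(real ^ 3) measure" where
  "area_S2 = distr
     (density (restrict_space lborel ({0..pi} \<times> {0..2 * pi}))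
        (\<lambda>(\<phi>, \<theta>). ennreal (norm (cross3
            (vector_derivative (\<lambda>u. sph_point u \<theta>) (at \<phi>))
            (vector_derivative (\<lambda>v. sph_point \<phi> v) (at \<theta>))))))
     (restrict_space borel S2)
     (\<lambda>(\<phi>, \<theta>). sph_point \<phi> \<theta>)"

definition sigma_S2 :: "(real ^ 3) measure" where
  "sigma_S2 = uniform_measure area_S2 S2"

text \<open>
  For a finite nonempty subset of the sphere this assigns to a set \<open>A\<close> of points of the sphere
  the value \<open>card (A \<inter> \<omega>) / card \<omega>\<close>.
\<close>

definition counting_S2 :: "(real ^ 3) set \<Rightarrow> (real ^ 3) measure" where
  "counting_S2 \<omega> = uniform_measure (count_space S2) \<omega>"

text \<open>
  Sequences of configurations are indexed from 1; the value at index 0 is irrelevant.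
\<close>

definition config_seq :: "(nat \<Rightarrow> (real ^ 3) set) \<Rightarrow> bool" where
  "config_seq \<omega> \<longleftrightarrow> (\<forall>N\<ge>1. finite (\<omega> N) \<and> \<omega> N \<subseteq> S2 \<and> card (\<omega> N) = N)"

definition equidistributed :: "(nat \<Rightarrow> (real ^ 3) set) \<Rightarrow> bool" where
  "equidistributed \<omega> \<longleftrightarrow> config_seq \<omega> \<and>
     (\<forall>f :: real ^ 3 \<Rightarrow> real. continuous_on S2 f \<longrightarrow>
        (\<lambda>N. integral\<^sup>L (counting_S2 (\<omega> N)) f) \<longlonglongrightarrow> integral\<^sup>L sigma_S2 f)"

definition separation :: "(real ^ 3) set \<Rightarrow> real" where
  "separation \<omega> = Min {dist x y | x y. x \<in> \<omega> \<and> y \<in> \<omega> \<and> x \<noteq> y}"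

text \<open>
  The supremum is attained for finite nonempty \<open>\<omega>\<close>, the sphere being compact;
  \<^const>\<open>Max\<close> is meaningful only on finite sets.
\<close>

definition covering_radius :: "(real ^ 3) set \<Rightarrow> real" where
  "covering_radius \<omega> = (SUP y\<in>S2. Min ((\<lambda>x. dist x y) ` \<omega>))"

definition mesh_ratio :: "(real ^ 3) set \<Rightarrow> real" where
  "mesh_ratio \<omega> = covering_radius \<omega> / separation \<omega>"

definition quasi_uniform :: "(nat \<Rightarrow> (real ^ 3) set) \<Rightarrow> bool" where
  "quasi_uniform \<omega> \<longleftrightarrow> config_seq \<omega> \<and> bounded ((\<lambda>N. mesh_ratio (\<omega> N)) ` {2..})"

definition spiral_h :: "nat \<Rightarrow> nat \<Rightarrow> real" where
  "spiral_h N k = 1 - (2 * real k - 1) / real N"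

definition spiral_phi :: "nat \<Rightarrow> nat \<Rightarrow> real" where
  "spiral_phi N k = arccos (spiral_h N k)"

definition spiral_theta :: "nat \<Rightarrow> nat \<Rightarrow> real" where
  "spiral_theta N k = sqrt (real N * pi) * spiral_phi N k"

definition spiral_points :: "nat \<Rightarrow> (real ^ 3) set" where
  "spiral_points N = (\<lambda>k. sph_point (spiral_phi N k) (spiral_theta N k)) ` {1..N}"

end

theory Submission
  imports Defs
begin

text \<open>
  For two spiral points whose indices differ by \<open>m\<close> put \<open>w = (\<phi>\<^sub>k - \<phi>\<^sub>j) / 2\<close>, \<open>v = L w\<close> and \<open>S = sin w\<close>.
  Since the heights differ by \<open>2 m / N\<close>, the sine of the mean polar angle is \<open>m / (N S)\<close>, and the
  squared distance times \<open>N\<close> becomes \<open>4 N S\<^sup>2 cos\<^sup>2 v + 4 m\<^sup>2 / (N S\<^sup>2) sin\<^sup>2 v\<close>, a function of \<open>m\<close> and \<open>w\<close>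
  alone which tends to \<open>4 v\<^sup>2 cos\<^sup>2 v / \<pi> + 4 \<pi> m\<^sup>2 sin\<^sup>2 v / v\<^sup>2\<close>. For fixed \<open>m\<close> the largest \<open>v\<close> occurs at
  the pole. For \<open>m = 1\<close> the limit function decreases on the admissible range, so the pair next to the
  pole is the closest one and gives the stated constant; all pairs with \<open>m \<ge> 2\<close> stay farther apart.
  Covering and equidistribution follow because consecutive turns of the spiral are \<open>2 \<pi> / L\<close> apart and
  the spiral stays within \<open>O(N\<^sup>-\<^sup>1\<^sup>/\<^sup>2)\<close> of the points.
\<close>

section \<open>Distances between spiral points\<close>

text \<open>Integrating \<open>sin y \<le> y\<close> twice gives first the quadratic bound for the
  cosine and then this one, the source of the chord and sinc estimates below.\<close>

lemma sin_ge_cubic: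
  fixes x :: real
  assumes "0 \<le> x"
  shows "x - x ^ 3 / 6 \<le> sin x"
proof -
  have c: "1 - y\<^sup>2 / 2 \<le> cos y" if "0 \<le> y" for y :: real
  proof -
    have "cos 0 - (1 - 0\<^sup>2 / 2) \<le> cos y - (1 - y\<^sup>2 / 2)"
      by (rule DERIV_nonneg_imp_nondecreasing[OF that, of "\<lambda>y. cos y - (1 - y\<^sup>2 / 2)"])
        (auto intro!: derivative_eq_intros exI sin_x_le_x)
    then show ?thesis by simp
  qed
  have "sin 0 - (0 - 0 ^ 3 / 6) \<le> sin x - (x - x ^ 3 / 6)"
  proof (rule DERIV_nonneg_imp_nondecreasing[OF assms, of "\<lambda>x. sin x - (x - x ^ 3 / 6)"])
    fix y :: real assume "0 \<le> y" "y \<le> x"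
    moreover have "((\<lambda>x. sin x - (x - x ^ 3 / 6)) has_real_derivative cos y - (1 - y\<^sup>2 / 2)) (at y)"
      by (auto intro!: derivative_eq_intros)
    ultimately show "\<exists>d. ((\<lambda>x. sin x - (x - x ^ 3 / 6)) has_real_derivative d) (at y) \<and> 0 \<le> d"
      using c by force
  qed
  then show ?thesis by simp
qed

section \<open>Chord lengths in spherical coordinates\<close>

lemma sph_point_component:
  "sph_point \<phi> \<theta> $ 1 = sin \<phi> * cos \<theta>"
  "sph_point \<phi> \<theta> $ 2 = sin \<phi> * sin \<theta>"
  "sph_point \<phi> \<theta> $ 3 = cos \<phi>"
  by (simp_all add: sph_point_def)

lemma dist_real3:
  fixes x y :: "real ^ 3"
  shows "(dist x y)\<^sup>2 = (x $ 1 - y $ 1)\<^sup>2 + (x $ 2 - y $ 2)\<^sup>2 + (x $ 3 - y $ 3)\<^sup>2"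
  unfolding dist_norm power2_norm_eq_inner by (simp add: inner_vec_def sum_3 power2_eq_square)

lemma sph_point_in_S2: "sph_point \<phi> \<theta> \<in> S2"
proof -
  have "(norm (sph_point \<phi> \<theta>))\<^sup>2 = (sin \<phi>)\<^sup>2 * ((cos \<theta>)\<^sup>2 + (sin \<theta>)\<^sup>2) + (cos \<phi>)\<^sup>2"
    using dist_real3[of "sph_point \<phi> \<theta>" 0]
    by (simp add: sph_point_component power_mult_distrib distrib_left del: sin_cos_squared_add sin_cos_squared_add2)
  then have "(norm (sph_point \<phi> \<theta>))\<^sup>2 = 1\<^sup>2"
    by (simp only: sin_cos_squared_add sin_cos_squared_add2) simp
  then have "norm (sph_point \<phi> \<theta>) = 1" by (rule power2_eq_imp_eq) simp_all
  then show ?thesis by simp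
qed

lemma sin_squared_cong:
  fixes x y :: real
  assumes "x = y \<or> x = - y"
  shows "(sin x)\<^sup>2 = (sin y)\<^sup>2"
  using assms by auto

lemma sin_half_squared: "4 * (sin (x / 2))\<^sup>2 = 2 - 2 * cos (x::real)"
  using cos_double_sin[of "x / 2"] by simp

text \<open>Haversine form of the spherical law of cosines: the chord splits into a polar and an
  azimuthal part, each a squared sine of a half difference.\<close>

lemma dist_sph_point:
  "(dist (sph_point a s) (sph_point b t))\<^sup>2 =
     4 * (sin ((a - b) / 2))\<^sup>2 + 4 * (sin a * sin b * (sin ((s - t) / 2))\<^sup>2)"
proof -
  have "(dist (sph_point a s) (sph_point b t))\<^sup>2 =
     (sin a)\<^sup>2 * ((sin s)\<^sup>2 + (cos s)\<^sup>2) + (sin b)\<^sup>2 * ((sin t)\<^sup>2 + (cos t)\<^sup>2) + (cos a)\<^sup>2 + (cos b)\<^sup>2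
     - 2 * cos a * cos b - 2 * sin a * sin b * cos (s - t)"
    unfolding dist_real3 sph_point_component cos_diff by algebra
  also have "\<dots> = (sin a)\<^sup>2 + (sin b)\<^sup>2 + (cos a)\<^sup>2 + (cos b)\<^sup>2
     - 2 * cos a * cos b - 2 * sin a * sin b * cos (s - t)"
    by (simp only: sin_cos_squared_add mult_1_right)
  also have "\<dots> = ((sin a)\<^sup>2 + (cos a)\<^sup>2) + ((sin b)\<^sup>2 + (cos b)\<^sup>2)
     - 2 * cos a * cos b - 2 * sin a * sin b * cos (s - t)"
    by (simp add: algebra_simps del: sin_cos_squared_add sin_cos_squared_add2)
  also have "\<dots> = 1 + 1 - 2 * cos a * cos b - 2 * sin a * sin b * cos (s - t)"
    by (simp only: sin_cos_squared_add)
  also have "\<dots> = (2 - 2 * cos (a - b)) + sin a * sin b * (2 - 2 * cos (s - t))"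
    by (simp add: cos_diff algebra_simps)
  also have "\<dots> = 4 * (sin ((a - b) / 2))\<^sup>2 + sin a * sin b * (4 * (sin ((s - t) / 2))\<^sup>2)"
    by (simp only: sin_half_squared)
  finally show ?thesis by simp
qed

text \<open>Expresses the weight of the azimuthal part through the mean angle, whose sine is
  determined by the spiral heights.\<close>

lemma sin_mult_sin_mean:
  fixes a b :: real
  shows "sin a * sin b = (sin ((a + b) / 2))\<^sup>2 - (sin ((b - a) / 2))\<^sup>2"
proof -
  have "4 * (sin ((a + b) / 2))\<^sup>2 = 2 - 2 * cos (a + b)" "4 * (sin ((b - a) / 2))\<^sup>2 = 2 - 2 * cos (b - a)"
    by (rule sin_half_squared)+
  then show ?thesis by (simp add: cos_add cos_diff algebra_simps)
qed

lemma sph_point_lipschitz_polar: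
  "dist (sph_point a t) (sph_point b t) \<le> \<bar>a - b\<bar>"
proof -
  have "(dist (sph_point a t) (sph_point b t))\<^sup>2 \<le> (a - b)\<^sup>2"
    using abs_sin_x_le_abs_x[of "(a - b) / 2"]
    unfolding dist_sph_point abs_le_square_iff by (simp add: power_divide)
  then show ?thesis by (simp add: abs_le_square_iff[symmetric])
qed

section \<open>Heights and polar angles of the spiral points\<close>

lemma spiral_h_bounds:
  assumes "1 \<le> k" "k \<le> N"
  shows "-1 < spiral_h N k" "spiral_h N k < 1"
  using assms by (simp_all add: spiral_h_def field_simps)

lemma cos_spiral_phi:
  assumes "1 \<le> k" "k \<le> N"
  shows "cos (spiral_phi N k) = spiral_h N k"
  using spiral_h_bounds[OF assms] by (simp add: spiral_phi_def)

lemma spiral_phi_bounds: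
  assumes "1 \<le> k" "k \<le> N"
  shows "0 < spiral_phi N k" "spiral_phi N k < pi"
  using arccos_lt_bounded spiral_h_bounds[OF assms] by (simp_all add: spiral_phi_def)

lemma spiral_phi_mono:
  assumes "1 \<le> j" "j \<le> k" "k \<le> N"
  shows "spiral_phi N j \<le> spiral_phi N k"
  unfolding spiral_phi_def
  using assms spiral_h_bounds[of j N] spiral_h_bounds[of k N]
  by (intro arccos_le_arccos) (auto simp: spiral_h_def divide_right_mono)

lemma spiral_phi_strict_mono:
  assumes "1 \<le> j" "j < k" "k \<le> N"
  shows "spiral_phi N j < spiral_phi N k"
  unfolding spiral_phi_def
  using assms spiral_h_bounds[of j N] spiral_h_bounds[of k N]
  by (intro arccos_less_arccos) (auto simp: spiral_h_def divide_strict_right_mono)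

text \<open>The heights are symmetric about the equator, which reduces the south pole to the north
  pole.\<close>

lemma spiral_phi_reflect:
  assumes "1 \<le> k" "k \<le> N"
  shows "spiral_phi N (N + 1 - k) = pi - spiral_phi N k"
proof -
  have "spiral_h N (N + 1 - k) = - spiral_h N k"
    using assms by (simp add: spiral_h_def of_nat_diff field_simps)
  then show ?thesis
    unfolding spiral_phi_def using spiral_h_bounds[OF assms] by (simp add: arccos_minus)
qed

definition spiral_point :: "nat \<Rightarrow> nat \<Rightarrow> real ^ 3" where
  "spiral_point N k = sph_point (spiral_phi N k) (spiral_theta N k)"

lemma spiral_points_eq: "spiral_points N = spiral_point N ` {1..N}"
  by (simp add: spiral_points_def spiral_point_def)

lemma inj_on_spiral_point: "inj_on (spiral_point N) {1..N}"
proof (rule inj_onI)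
  fix j k assume jk: "j \<in> {1..N}" "k \<in> {1..N}" "spiral_point N j = spiral_point N k"
  \<comment> \<open>The third coordinate alone separates the points.\<close>
  then have "cos (spiral_phi N j) = cos (spiral_phi N k)"
    unfolding spiral_point_def by (metis sph_point_component(3))
  then have "spiral_h N j = spiral_h N k" using jk by (simp add: cos_spiral_phi)
  then show "j = k" using jk by (simp add: spiral_h_def)
qed

lemma config_seq_spiral_points: "config_seq spiral_points"
  unfolding config_seq_def spiral_points_eq
  using sph_point_in_S2 by (auto simp: card_image[OF inj_on_spiral_point, simplified]) (simp add: spiral_point_def)

text \<open>Multiplied by \<open>sqrt (N * pi)\<close> this is also half the azimuth difference, so
  one number governs both parts of the chord.\<close>

definition half_gap :: "nat \<Rightarrow> nat \<Rightarrow> nat \<Rightarrow> real" where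
  "half_gap N j k = (spiral_phi N k - spiral_phi N j) / 2"

lemma half_gap_bounds:
  assumes "1 \<le> j" "j < k" "k \<le> N"
  shows "0 < half_gap N j k" "half_gap N j k < pi / 2"
  using spiral_phi_strict_mono[OF assms] spiral_phi_bounds[of j N] spiral_phi_bounds[of k N] assms
  by (simp_all add: half_gap_def)

text \<open>The heights form an arithmetic progression, so the difference of the two cosines depends
  on \<open>k - j\<close> only. This identity removes the position on the sphere from the
  distance.\<close>

lemma sin_mean_mult_sin_half_gap:
  assumes "1 \<le> j" "j < k" "k \<le> N"
  shows "sin ((spiral_phi N j + spiral_phi N k) / 2) * sin (half_gap N j k) = real (k - j) / real N"
proof -
  have "2 * (sin ((spiral_phi N j + spiral_phi N k) / 2) * sin (half_gap N j k))
      = cos (spiral_phi N j) - cos (spiral_phi N k)"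
    by (simp add: cos_diff_cos half_gap_def)
  also have "\<dots> = 2 * (real (k - j) / real N)"
    using assms by (simp add: cos_spiral_phi spiral_h_def of_nat_diff field_simps)
  finally show ?thesis by simp
qed

text \<open>The product of the two sines is fixed at \<open>m / N\<close>, so the gap is widest
  where the sine of the mean angle is smallest. The mean angle of every pair lies between that of
  the first pair and its supplement.\<close>

lemma half_gap_le_polar_gap:
  assumes "1 \<le> j" "1 \<le> m" "j + m \<le> N"
  shows "half_gap N j (j + m) \<le> half_gap N 1 (1 + m)"
proof -
  define M where "M i = (spiral_phi N i + spiral_phi N (i + m)) / 2" for i
  have prod: "sin (M i) * sin (half_gap N i (i + m)) = real m / real N" if "1 \<le> i" "i + m \<le> N" for i
    using sin_mean_mult_sin_half_gap[of i "i + m" N] that assms by (simp add: M_def)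
  have "M 1 \<le> M j"
    using spiral_phi_mono[of 1 j N] spiral_phi_mono[of "1 + m" "j + m" N] assms by (simp add: M_def)
  moreover have "M j \<le> pi - M 1"
  proof -
    \<comment> \<open>The last pair with index difference \<open>m\<close> is the mirror image of
      the first.\<close>
    have "spiral_phi N j \<le> spiral_phi N (N + 1 - (1 + m))"
      "spiral_phi N (j + m) \<le> spiral_phi N (N + 1 - 1)"
      using assms by (auto intro!: spiral_phi_mono)
    then have "spiral_phi N j \<le> pi - spiral_phi N (1 + m)" "spiral_phi N (j + m) \<le> pi - spiral_phi N 1"
      using spiral_phi_reflect[of "1 + m" N] spiral_phi_reflect[of 1 N] assms by auto
    then show ?thesis by (simp add: M_def add_divide_distrib)
  qed
  moreover have "0 < M 1" "M 1 < pi"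
    using spiral_phi_bounds[of 1 N] spiral_phi_bounds[of "1 + m" N] assms by (auto simp: M_def)
  ultimately have M: "sin (M 1) \<le> sin (M j)" and M1: "0 < sin (M 1)"
    using sin_monotone_2pi_le[of "M 1" "M j"] sin_monotone_2pi_le[of "M 1" "pi - M j"]
    by (cases "M j \<le> pi / 2"; force simp: sin_gt_zero)+
  note b1 = half_gap_bounds[of 1 "1 + m" N] and bj = half_gap_bounds[of j "j + m" N]
  have s1: "0 < sin (half_gap N 1 (1 + m))" 
    using b1 assms by (intro sin_gt_zero) auto
  have sj: "0 < sin (half_gap N j (j + m))"
    using bj assms by (intro sin_gt_zero) auto
  have "sin (M 1) * sin (half_gap N j (j + m)) \<le> sin (M j) * sin (half_gap N j (j + m))"
    using M sj by simp
  also have "\<dots> = sin (M 1) * sin (half_gap N 1 (1 + m))"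
    using prod[of 1] prod[of j] assms by simp
  finally have "sin (half_gap N j (j + m)) \<le> sin (half_gap N 1 (1 + m))"
    using M1 by simp
  then show ?thesis
    using b1 bj assms by (subst (asm) sin_mono_le_eq) auto
qed

text \<open>The azimuthal weight is \<open>P\<^sup>2 - S\<^sup>2\<close> with \<open>P\<close> the
  sine of the mean angle. The \<open>S\<close> terms merge into a squared cosine, and
  \<open>P = (k - j) / (N * S)\<close> eliminates the mean angle.\<close>

lemma dist_spiral_point:
  assumes "1 \<le> j" "j < k" "k \<le> N"
  defines "S \<equiv> sin (half_gap N j k)" and "v \<equiv> sqrt (real N * pi) * half_gap N j k"
  shows "real N * (dist (spiral_point N j) (spiral_point N k))\<^sup>2 =
    4 * (real N * S\<^sup>2) * (cos v)\<^sup>2 + 4 * (real (k - j))\<^sup>2 / (real N * S\<^sup>2) * (sin v)\<^sup>2"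
proof -
  have N: "real N > 0" using assms by simp
  have S: "S > 0" unfolding S_def using half_gap_bounds[OF assms(1-3)] by (intro sin_gt_zero) auto
  define P where "P = sin ((spiral_phi N j + spiral_phi N k) / 2)"
  have PS: "P = real (k - j) / (real N * S)"
    using sin_mean_mult_sin_half_gap[OF assms(1-3)] S N by (simp add: P_def S_def field_simps)
  have sq: "(sin ((spiral_phi N j - spiral_phi N k) / 2))\<^sup>2 = S\<^sup>2"
     "(sin ((spiral_theta N j - spiral_theta N k) / 2))\<^sup>2 = (sin v)\<^sup>2"
    unfolding S_def by (rule sin_squared_cong; simp add: half_gap_def spiral_theta_def v_def field_simps)+
  have "(dist (spiral_point N j) (spiral_point N k))\<^sup>2 = 4 * S\<^sup>2 + 4 * ((P\<^sup>2 - S\<^sup>2) * (sin v)\<^sup>2)"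
    unfolding spiral_point_def dist_sph_point sq
    unfolding sin_mult_sin_mean P_def S_def half_gap_def by simp
  also have "\<dots> = 4 * S\<^sup>2 * (cos v)\<^sup>2 + 4 * P\<^sup>2 * (sin v)\<^sup>2"
    by (simp add: sin_squared_eq algebra_simps)
  finally have "real N * (dist (spiral_point N j) (spiral_point N k))\<^sup>2 =
     4 * (real N * S\<^sup>2) * (cos v)\<^sup>2 + 4 * (real N * P\<^sup>2) * (sin v)\<^sup>2"
    by (simp add: algebra_simps)
  also have "real N * P\<^sup>2 = (real (k - j))\<^sup>2 / (real N * S\<^sup>2)"
    unfolding PS using N S by (simp add: power_divide power_mult_distrib power2_eq_square)
  finally show ?thesis by simp
qed

text \<open>Keeps the polar part only; this settles pairs with a wide polar gap, whose azimuths are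
  not controlled.\<close>

lemma dist_spiral_point_ge:
  assumes "1 \<le> j" "j < k" "k \<le> N"
  shows "4 * (real N * (sin (half_gap N j k))\<^sup>2) \<le> real N * (dist (spiral_point N j) (spiral_point N k))\<^sup>2"
proof -
  have "sin (spiral_phi N j) * sin (spiral_phi N k) \<ge> 0"
    using spiral_phi_bounds[of j N] spiral_phi_bounds[of k N] assms
    by (intro mult_nonneg_nonneg sin_ge_zero) auto
  moreover have "(sin ((spiral_phi N j - spiral_phi N k) / 2))\<^sup>2 = (sin (half_gap N j k))\<^sup>2"
    by (rule sin_squared_cong) (simp add: half_gap_def field_simps)
  ultimately have "4 * (sin (half_gap N j k))\<^sup>2 \<le> (dist (spiral_point N j) (spiral_point N k))\<^sup>2"
    unfolding spiral_point_def dist_sph_point by simp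
  from mult_left_mono[OF this, of "real N"] show ?thesis by (simp add: mult.left_commute)
qed

text \<open>The height condition bounds only the product \<open>P * sin w\<close>, by
  \<open>1 / (2 * N)\<close>. Both parts of the chord reduce to this product: the polar part since
  \<open>sin w \<le> P\<close>, the azimuthal part since \<open>w\<close> is at most a multiple of
  \<open>sin w\<close>. This treats the poles and the equator alike.\<close>

lemma dist_spiral_curve:
  assumes k: "1 \<le> k" "k \<le> N" and a: "0 \<le> a" "a \<le> pi"
    and close: "\<bar>cos a - spiral_h N k\<bar> \<le> 1 / real N"
  shows "dist (sph_point a (sqrt (real N * pi) * a)) (spiral_point N k) \<le> 4 / sqrt (real N)"
proof -
  have N: "real N > 0" using k by simp
  define b where "b = spiral_phi N k"
  define w where "w = \<bar>a - b\<bar> / 2"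
  define P where "P = sin ((a + b) / 2)"
  have b: "0 < b" "b < pi" using spiral_phi_bounds[OF k] by (simp_all add: b_def)
  have w: "0 \<le> w" "w \<le> pi / 2" using a b by (auto simp: w_def abs_if)
  have S0: "0 \<le> sin w" using w by (intro sin_ge_zero) auto
  have "\<bar>2 * P * sin ((b - a) / 2)\<bar> \<le> 1 / real N"
    using close k by (simp add: cos_spiral_phi[symmetric] cos_diff_cos P_def b_def)
  moreover have "\<bar>sin ((b - a) / 2)\<bar> = sin w"
    using S0 sin_minus[of "(b - a) / 2"] unfolding w_def
    by (cases "a \<le> b") (auto simp: abs_if minus_divide_left simp del: sin_minus)
  moreover have P0: "0 \<le> P" unfolding P_def using a b by (intro sin_ge_zero) auto
  ultimately have PS: "P * sin w \<le> 1 / (2 * real N)"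
    by (simp add: abs_mult field_simps)
  have SP: "sin w \<le> P"
  proof -
    have "0 \<le> sin a * sin b" using a b by (intro mult_nonneg_nonneg sin_ge_zero) auto
    then have "(sin ((b - a) / 2))\<^sup>2 \<le> P\<^sup>2" by (simp add: sin_mult_sin_mean P_def)
    then have "(sin w)\<^sup>2 \<le> P\<^sup>2" using \<open>\<bar>sin ((b - a) / 2)\<bar> = sin w\<close> by (metis power2_abs)
    then show ?thesis using P0 by (rule power2_le_imp_le)
  qed
  \<comment> \<open>A weak Jordan inequality: up to 1 the cubic bound gives
    \<open>sin w \<ge> 5 * w / 6\<close>; beyond 1 the sine is at least 5/6 while
    \<open>w \<le> pi / 2 < 5 / 3\<close>.\<close>
  have jordan: "w \<le> 2 * sin w"
  proof (cases "w \<le> 1")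
    case True
    then have "w ^ 3 \<le> w * 1" using w by (simp add: power3_eq_cube mult_le_one mult.assoc mult_left_le)
    then show ?thesis using sin_ge_cubic[of w] w by linarith
  next
    case False
    have "5 / 6 \<le> sin (1::real)" using sin_ge_cubic[of 1] by simp
    also have "sin 1 \<le> sin w" using False w by (intro sin_monotone_2pi_le) auto
    finally show ?thesis using w pi_approx by simp
  qed
  define L where "L = sqrt (real N * pi)"
  have L2: "L\<^sup>2 = real N * pi" by (simp add: L_def)
  have "(dist (sph_point a (L * a)) (spiral_point N k))\<^sup>2
      = 4 * (sin ((b - a) / 2))\<^sup>2 + 4 * ((P\<^sup>2 - (sin ((b - a) / 2))\<^sup>2) * (sin (L * (a - b) / 2))\<^sup>2)"
    unfolding spiral_point_def dist_sph_point b_def[symmetric] spiral_theta_def L_def[symmetric] sin_mult_sin_mean P_def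
    by (simp add: algebra_simps sin_squared_cong[of "(a - b) / 2" "(b - a) / 2"] minus_divide_left)
  also have "(sin ((b - a) / 2))\<^sup>2 = (sin w)\<^sup>2"
    using \<open>\<bar>sin ((b - a) / 2)\<bar> = sin w\<close> by (metis power2_abs)
  also have "(P\<^sup>2 - (sin w)\<^sup>2) * (sin (L * (a - b) / 2))\<^sup>2 \<le> P\<^sup>2 * (L * w)\<^sup>2"
  proof (rule mult_mono)
    have "\<bar>sin (L * (a - b) / 2)\<bar> \<le> \<bar>L * w\<bar>"
      using abs_sin_x_le_abs_x[of "L * (a - b) / 2"] by (simp add: w_def abs_mult)
    then show "(sin (L * (a - b) / 2))\<^sup>2 \<le> (L * w)\<^sup>2" by (simp only: abs_le_square_iff)
  qed auto
  also have "P\<^sup>2 * (L * w)\<^sup>2 \<le> P\<^sup>2 * (L * (2 * sin w))\<^sup>2"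
    using jordan w by (intro mult_left_mono power_mono) (auto simp: L_def intro!: mult_left_mono)
  also have "\<dots> = 4 * (real N * pi) * (P * sin w)\<^sup>2"
    by (simp add: power_mult_distrib L2)
  also have "(P * sin w)\<^sup>2 \<le> (1 / (2 * real N))\<^sup>2"
    using PS P0 S0 by (intro power_mono) auto
  also have "4 * (real N * pi) * (1 / (2 * real N))\<^sup>2 = pi / real N"
    using N by (simp add: power2_eq_square)
  also have "(sin w)\<^sup>2 \<le> P * sin w"
    using SP S0 by (simp add: power2_eq_square mult_right_mono)
  also note PS
  finally have "(dist (sph_point a (L * a)) (spiral_point N k))\<^sup>2 \<le> 4 * (1 / (2 * real N)) + 4 * (pi / real N)"
    using N by simp
  \<comment> \<open>The sum is \<open>(2 + 4 * pi) / N\<close>, below \<open>16 / N\<close>; hence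
    the constant 4.\<close>
  also have "\<dots> \<le> (4 / sqrt (real N))\<^sup>2"
    using N pi_approx by (simp add: power_divide field_simps)
  finally show ?thesis
    unfolding L_def by (rule power2_le_imp_le) simp
qed

section \<open>The limiting distance function\<close>

text \<open>The derivative of \<open>sin x - x * cos x\<close> is \<open>x * sin x\<close>, to which
  the cubic bound applies. The expression is the negated numerator in the derivative of
  \<open>sin x / x\<close>.\<close>

lemma sin_minus_x_cos_ge:
  fixes x :: real
  assumes "0 \<le> x"
  shows "x ^ 3 / 3 - x ^ 5 / 30 \<le> sin x - x * cos x"
proof -
  let ?f = "\<lambda>x::real. sin x - x * cos x - (x ^ 3 / 3 - x ^ 5 / 30)"
  have "?f 0 \<le> ?f x"
  proof (rule DERIV_nonneg_imp_nondecreasing[OF assms])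
    fix y :: real assume y: "0 \<le> y" "y \<le> x"
    have "(?f has_real_derivative y * sin y - (y\<^sup>2 - y ^ 4 / 6)) (at y)"
      by (auto intro!: derivative_eq_intros)
    moreover have "y * (y - y ^ 3 / 6) \<le> y * sin y"
      using y sin_ge_cubic by (intro mult_left_mono) auto
    then have "0 \<le> y * sin y - (y\<^sup>2 - y ^ 4 / 6)"
      by (simp add: algebra_simps power2_eq_square power3_eq_cube power4_eq_xxxx)
    ultimately show "\<exists>d. (?f has_real_derivative d) (at y) \<and> 0 \<le> d" by blast
  qed
  then show ?thesis by simp
qed

lemma x_cos_le_sin:
  fixes x :: real
  assumes "0 \<le> x" "x \<le> pi"
  shows "x * cos x \<le> sin x"
proof -
  let ?f = "\<lambda>x::real. sin x - x * cos x"
  have "?f 0 \<le> ?f x"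
  proof (rule DERIV_nonneg_imp_nondecreasing[OF assms(1)])
    fix y :: real assume y: "0 \<le> y" "y \<le> x"
    have "(?f has_real_derivative y * sin y) (at y)"
      by (auto intro!: derivative_eq_intros)
    moreover have "0 \<le> y * sin y"
      using y assms by (intro mult_nonneg_nonneg sin_ge_zero) auto
    ultimately show "\<exists>d. (?f has_real_derivative d) (at y) \<and> 0 \<le> d" by blast
  qed
  then show ?thesis by simp
qed

lemma sinc_antimono:
  fixes x y :: real
  assumes "0 < x" "x \<le> y" "y \<le> pi"
  shows "sin y / y \<le> sin x / x"
proof (rule DERIV_nonpos_imp_nonincreasing[OF assms(2), of "\<lambda>x. sin x / x"])
  fix z assume z: "x \<le> z" "z \<le> y"
  have "((\<lambda>x. sin x / x) has_real_derivative (z * cos z - sin z) / z\<^sup>2) (at z)"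
    using z assms by (auto intro!: derivative_eq_intros simp: power2_eq_square mult.commute)
  moreover have "(z * cos z - sin z) / z\<^sup>2 \<le> 0"
    using x_cos_le_sin[of z] z assms by (simp add: divide_le_0_iff)
  ultimately show "\<exists>d. ((\<lambda>x. sin x / x) has_real_derivative d) (at z) \<and> d \<le> 0" by blast
qed

text \<open>Reflection \<open>sin x = sin (pi - x)\<close> with the rational lower bound 3.1415 for
  pi; \<open>1.6 \<le> x\<close> keeps \<open>pi - x\<close> where the sine increases.\<close>

lemma sin_ge_cubic_near_pi:
  fixes x :: real
  assumes "1.6 \<le> x" "x \<le> 3.1415"
  shows "(3.1415 - x) - (3.1415 - x) ^ 3 / 6 \<le> sin x"
proof -
  have "(3.1415 - x) - (3.1415 - x) ^ 3 / 6 \<le> sin (3.1415 - x)"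
    using assms by (intro sin_ge_cubic) simp
  also have "\<dots> \<le> sin (pi - x)"
    using assms pi_approx by (intro sin_monotone_2pi_le) auto
  finally show ?thesis by simp
qed

text \<open>
  In the limit, with \<open>v\<close> half the azimuth difference of two points whose indices differ by \<open>m\<close>,
  this is the squared distance multiplied by \<open>N\<close>.
\<close>

definition planar :: "nat \<Rightarrow> real \<Rightarrow> real" where
  "planar m v = 4 * (v\<^sup>2 / pi) * (cos v)\<^sup>2 + 4 * (real m)\<^sup>2 / (v\<^sup>2 / pi) * (sin v)\<^sup>2"

text \<open>The cosine term adds at most \<open>8 / pi * z\<close> to the derivative, while the sine
  term subtracts at least \<open>2 * pi * z\<close>, which is larger.\<close>

lemma planar_1_antimono:
  assumes "0 < x" "x \<le> y" "y \<le> 1"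
  shows "planar 1 y \<le> planar 1 x"
proof (rule DERIV_nonpos_imp_nonincreasing[OF assms(2)])
  fix z assume "x \<le> z" "z \<le> y"
  then have z: "0 < z" "z \<le> 1" using assms by auto
  define d where "d = 8 / pi * (z * cos z * (cos z - z * sin z)) - 8 * pi * (sin z * (sin z - z * cos z) / z ^ 3)"
  have "(planar 1 has_real_derivative d) (at z)"
    unfolding planar_def d_def using z
    by (auto intro!: derivative_eq_intros simp: field_simps) algebra
  moreover have "d \<le> 0"
  proof -
    have c: "0 \<le> cos z" and s: "0 \<le> sin z"
      using z pi_approx by (auto intro!: cos_ge_zero sin_ge_zero)
    have "0 \<le> z * sin z" using z s by simp
    then have "cos z - z * sin z \<le> 1" using cos_le_one[of z] by linarith
    then have "z * cos z * (cos z - z * sin z) \<le> z * cos z * 1"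
      using z c by (intro mult_left_mono) auto
    also have "\<dots> \<le> z * 1" unfolding mult_1_right using z mult_left_mono[OF cos_le_one[of z], of z] by simp
    finally have 1: "8 / pi * (z * cos z * (cos z - z * sin z)) \<le> 8 / pi * z"
      by (simp add: divide_right_mono)
    have z2: "z\<^sup>2 \<le> 1" using z by (simp add: power_le_one)
    \<comment> \<open>For \<open>z\<^sup>2 \<le> 1\<close> the Taylor factors below are at least 5/6
      and 9/30, whose product is 1/4.\<close>
    have "z / 4 = z * (5 / 6) * (9 / 30)" by simp
    also have "\<dots> \<le> z * (1 - z\<^sup>2 / 6) * (10 / 30 - z\<^sup>2 / 30)"
      using z z2 by (intro mult_mono) auto
    also have "\<dots> = (z - z ^ 3 / 6) * (z ^ 3 / 3 - z ^ 5 / 30) / z ^ 3"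
      using z by (simp add: field_simps) algebra
    also have "\<dots> \<le> sin z * (sin z - z * cos z) / z ^ 3"
    proof (intro divide_right_mono mult_mono)
      have "z ^ 5 \<le> z ^ 3" "0 \<le> z ^ 3" using power_decreasing[of 3 5 z] z by simp_all
      then show "0 \<le> z ^ 3 / 3 - z ^ 5 / 30" by linarith
    qed (use z s sin_ge_cubic sin_minus_x_cos_ge in auto)
    finally have "8 * pi * (z / 4) \<le> 8 * pi * (sin z * (sin z - z * cos z) / z ^ 3)"
      by (intro mult_left_mono) auto
    with 1 have "d \<le> 8 / pi * z - 2 * pi * z" by (simp add: d_def)
    also have "8 / pi \<le> 2 * pi"
      using mult_mono[of 3 pi 3 pi] pi_approx by (simp add: divide_le_eq)
    finally show ?thesis using z by simp
  qed
  ultimately show "\<exists>d. (planar 1 has_real_derivative d) (at z) \<and> d \<le> 0" by blast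
qed

text \<open>Without its cosine term \<open>planar m v\<close> is
  \<open>4 * pi * m\<^sup>2 * (sin v / v)\<^sup>2\<close>. The sinc function decreases, so an
  \<open>s\<close> below its value at \<open>a\<close> serves for all
  \<open>v \<le> a\<close>.\<close>

lemma planar_ge_sinc:
  assumes "0 < v" "v \<le> a" "a \<le> pi" "0 \<le> s" "s * a \<le> sin a"
  shows "4 * pi * (real m)\<^sup>2 * s\<^sup>2 \<le> planar m v - 4 * (v\<^sup>2 / pi) * (cos v)\<^sup>2"
proof -
  have "s \<le> sin a / a" using assms by (simp add: le_divide_eq)
  also have "\<dots> \<le> sin v / v" using assms by (intro sinc_antimono)
  finally have "s\<^sup>2 \<le> (sin v / v)\<^sup>2" using assms(4) by (rule power_mono)
  then have "4 * pi * (real m)\<^sup>2 * s\<^sup>2 \<le> 4 * pi * (real m)\<^sup>2 * (sin v / v)\<^sup>2"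
    by (intro mult_left_mono) auto
  also have "\<dots> = planar m v - 4 * (v\<^sup>2 / pi) * (cos v)\<^sup>2"
    by (simp add: planar_def power_divide)
  finally show ?thesis .
qed

text \<open>Rational version: once \<open>a\<close>, \<open>M\<close>, \<open>s\<close> and
  \<open>c\<close> are numerals, the last three hypotheses are plain arithmetic.\<close>

lemma planar_ge_by_sinc:
  assumes "0 < v" "v \<le> a" "1.6 \<le> a" "a \<le> 3.1415" "M \<le> m"
    and "0 \<le> s" "s * a \<le> (3.1415 - a) - (3.1415 - a) ^ 3 / 6"
    and "c \<le> 4 * 3.1415 * (real M)\<^sup>2 * s\<^sup>2"
  shows "c \<le> planar m v - 4 * (v\<^sup>2 / pi) * (cos v)\<^sup>2"
proof -
  note assms(8)
  also have "4 * 3.1415 * (real M)\<^sup>2 * s\<^sup>2 \<le> 4 * pi * (real m)\<^sup>2 * s\<^sup>2"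
    using pi_approx assms(5,6) by (intro mult_mono power_mono) auto
  also have "\<dots> \<le> planar m v - 4 * (v\<^sup>2 / pi) * (cos v)\<^sup>2"
    using assms pi_approx sin_ge_cubic_near_pi[of a] by (intro planar_ge_sinc) auto
  finally show ?thesis .
qed

text \<open>
  The extra bounds on \<open>v\<close> for small \<open>m\<close> are slightly above the limits of \<open>v\<close> at the pole,
  which are about \<open>1.55\<close>, \<open>2.06\<close> and \<open>2.507\<close>.
\<close>

lemma planar_ge:
  assumes "0 < v" "2 \<le> m" "v \<le> 2.8"
    and "m = 2 \<Longrightarrow> v \<le> 1.6" "m = 3 \<Longrightarrow> v \<le> 2.1" "m = 4 \<Longrightarrow> v \<le> 2.51"
  shows "9.9 \<le> planar m v"
proof -
  have nn: "0 \<le> 4 * (v\<^sup>2 / pi) * (cos v)\<^sup>2" by simp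
  consider "m = 2" | "m = 3" | "m = 4" | "5 \<le> m" using assms(2) by linarith
  then show ?thesis
  proof cases
    case 1
    \<comment> \<open>In each instance \<open>a\<close> is the largest \<open>v\<close> allowed in
      the case and \<open>s\<close> is a rational below \<open>sin a / a\<close>.\<close>
    have "9.9 \<le> planar m v - 4 * (v\<^sup>2 / pi) * (cos v)\<^sup>2"
      by (rule planar_ge_by_sinc[of v "1.6" 2 m "0.5"]) (use 1 assms in \<open>simp_all add: power3_eq_cube power2_eq_square\<close>)
    with nn show ?thesis by linarith
  next
    case 2
    have "9.9 \<le> planar m v - 4 * (v\<^sup>2 / pi) * (cos v)\<^sup>2"
      by (rule planar_ge_by_sinc[of v "2.1" 3 m "0.4"]) (use 2 assms in \<open>simp_all add: power3_eq_cube power2_eq_square\<close>)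
    with nn show ?thesis by linarith
  next
    case 3
    have "9.9 \<le> planar m v - 4 * (v\<^sup>2 / pi) * (cos v)\<^sup>2"
      by (rule planar_ge_by_sinc[of v "2.51" 4 m "0.23"]) (use 3 assms in \<open>simp_all add: power3_eq_cube power2_eq_square\<close>)
    with nn show ?thesis by linarith
  next
    case 4
    show ?thesis
    proof (cases "v \<le> 2.6")
      case True
      have "9.9 \<le> planar m v - 4 * (v\<^sup>2 / pi) * (cos v)\<^sup>2"
        by (rule planar_ge_by_sinc[of v "2.6" 5 m "0.19"]) (use 4 True assms in \<open>simp_all add: power3_eq_cube power2_eq_square\<close>)
      with nn show ?thesis by linarith
    next
      case False
      \<comment> \<open>Up to 2.8 the sine term guarantees only 4 here, but \<open>v\<close> is now
        close to pi and the cosine term supplies the missing 5.9.\<close>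
      have "4 \<le> planar m v - 4 * (v\<^sup>2 / pi) * (cos v)\<^sup>2"
        by (rule planar_ge_by_sinc[of v "2.8" 5 m "0.115"]) (use 4 assms in \<open>simp_all add: power3_eq_cube power2_eq_square\<close>)
      moreover have "5.9 \<le> 4 * (v\<^sup>2 / pi) * (cos v)\<^sup>2"
      proof -
        have "0 \<le> sin (pi - v)" using assms pi_approx False by (intro sin_ge_zero) auto
        \<comment> \<open>0.542 is slightly above \<open>pi - 2.6\<close>.\<close>
        moreover have "sin (pi - v) \<le> 0.542" 
          using sin_x_le_x[of "pi - v"] False assms pi_approx by simp
        ultimately have "(sin (pi - v))\<^sup>2 \<le> 0.542\<^sup>2" by (intro power_mono) auto
        then have "(sin v)\<^sup>2 \<le> 0.3" by (simp add: power2_eq_square)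
        then have c: "0.7 \<le> (cos v)\<^sup>2" using sin_cos_squared_add[of v] by linarith
        have "2.6\<^sup>2 \<le> v\<^sup>2" using False by (intro power_mono) auto
        moreover have "1 / 3.142 \<le> 1 / pi" using pi_approx by (intro divide_left_mono) auto
        ultimately have "2.6\<^sup>2 * (1 / 3.142) * 0.7 \<le> v\<^sup>2 * (1 / pi) * (cos v)\<^sup>2"
          using c by (intro mult_mono) auto
        then show ?thesis by (simp add: power2_eq_square)
      qed
      ultimately show ?thesis by linarith
    qed
  qed
qed

text \<open>A shift by \<open>pi / 2\<close> turns the cosine into \<open>- sin y\<close> with
  \<open>y\<close> near 0.264, where the Taylor polynomial of degree 5 is accurate enough. The bound
  9.9 places the constant below the values that \<open>planar_ge\<close> provides for
  \<open>m \<ge> 2\<close>.\<close>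

lemma separation_constant_bounds:
  defines "D \<equiv> 8 - 4 * sqrt 3 * cos (sqrt (2 * pi) * (1 - sqrt 3))"
  shows "\<bar>sqrt D - 3.131948\<bar> \<le> 5 / 10 ^ 7" and "D < 9.9"
proof -
  define y where "y = sqrt (2 * pi) * (sqrt 3 - 1) - pi / 2"
  have s3: "1.73205080756 \<le> sqrt 3" "sqrt 3 \<le> 1.73205080757"
    by (rule real_le_rsqrt, simp add: power2_eq_square) (rule real_le_lsqrt; simp add: power2_eq_square)
  have s2pi: "2.5066282746 \<le> sqrt (2 * pi)" "sqrt (2 * pi) \<le> 2.5066282747"
    by (rule real_le_rsqrt, use pi_approx in \<open>simp add: power2_eq_square\<close>)
      (rule real_le_lsqrt; use pi_approx in \<open>simp add: power2_eq_square\<close>)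
  have "2.5066282746 * 0.73205080756 \<le> sqrt (2 * pi) * (sqrt 3 - 1)"
    using s3 s2pi by (intro mult_mono) auto
  then have ylo: "0.264182923 \<le> y" using pi_approx unfolding y_def by simp
  have "sqrt (2 * pi) * (sqrt 3 - 1) \<le> 2.5066282747 * 0.73205080757"
    using s3 s2pi by (intro mult_mono) auto
  then have yhi: "y \<le> 0.264182927" using pi_approx unfolding y_def by simp
  have "cos (sqrt (2 * pi) * (1 - sqrt 3)) = cos (y + pi / 2)"
    unfolding y_def by (subst cos_minus[symmetric]) (simp add: algebra_simps)
  also have "\<dots> = - sin y" by (simp add: cos_add)
  finally have D: "D = 8 + 4 * sqrt 3 * sin y" by (simp add: D_def)
  have taylor: "\<bar>sin x - (x - x ^ 3 / 6 + x ^ 5 / 120)\<bar> \<le> \<bar>x\<bar> ^ 7 / 5040" for x :: real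
  proof -
    have "{..<7} = {0, 1, 2, 3, 4, 5, 6::nat}" by auto
    then have "(\<Sum>m<7. sin_coeff m * x ^ m) = x - x ^ 3 / 6 + x ^ 5 / 120"
      by (simp add: sin_coeff_def fact_numeral)
    moreover have "inverse (fact 7 :: real) * \<bar>x\<bar> ^ 7 = \<bar>x\<bar> ^ 7 / 5040"
      by (simp add: fact_numeral)
    ultimately show ?thesis using Maclaurin_sin_bound[of x 7] by (simp only:)
  qed
  have "sin 0.264182923 \<le> sin y" using ylo yhi pi_approx by (intro sin_monotone_2pi_le) auto
  moreover have "0.26112055 \<le> sin (0.264182923::real)" 
    using abs_le_D2[OF taylor[of "0.264182923"]] by (simp add: eval_nat_numeral)
  ultimately have lo: "0.26112055 \<le> sin y" by simp
  have "sin y \<le> sin 0.264182927" using ylo yhi pi_approx by (intro sin_monotone_2pi_le) auto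
  moreover have "sin (0.264182927::real) \<le> 0.2611208" 
    using abs_le_D1[OF taylor[of "0.264182927"]] by (simp add: eval_nat_numeral)
  ultimately have hi: "sin y \<le> 0.2611208" by simp
  have "1.73205080756 * 0.26112055 \<le> sqrt 3 * sin y" "sqrt 3 * sin y \<le> 1.73205080757 * 0.2611208"
    using s3 lo hi by (intro mult_mono; simp)+
  then have "3.1319475\<^sup>2 \<le> D" "D \<le> 3.1319485\<^sup>2" "D < 9.9"
    by (simp_all add: D power2_eq_square)
  moreover from this have "3.1319475 \<le> sqrt D" by (intro real_le_rsqrt)
  moreover have "sqrt D \<le> 3.1319485" using \<open>D \<le> 3.1319485\<^sup>2\<close> by (intro real_le_lsqrt) auto
  ultimately show "D < 9.9" "\<bar>sqrt D - 3.131948\<bar> \<le> 5 / 10 ^ 7"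
    by (simp_all add: abs_if)
qed

section \<open>The separation\<close>

text \<open>Half the azimuth difference of the pair at the north pole with index difference
  \<open>m\<close>; by \<open>half_gap_le_polar_gap\<close> the largest for that
  \<open>m\<close>.\<close>

definition half_turn :: "nat \<Rightarrow> nat \<Rightarrow> real" where
  "half_turn N m = sqrt (real N * pi) * half_gap N 1 (1 + m)"

text \<open>For fixed \<open>k\<close> the angle \<open>spiral_phi N k\<close> behaves like
  \<open>2 * sqrt ((2 * k - 1) / (2 * N))\<close>. Inserting \<open>k = 1 + m\<close> and
  \<open>k = 1\<close> into \<open>half_turn\<close> gives this limit.\<close>

definition half_turn_limit :: "nat \<Rightarrow> real" where
  "half_turn_limit m = sqrt pi * (sqrt ((2 * real m + 1) / 2) - sqrt (1 / 2))"

text \<open>The half-angle form \<open>1 - cos x = 2 * (sin (x / 2))\<^sup>2\<close> avoids the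
  singularity of arccos at 1: arcsin is differentiable at 0, which yields the asymptotics at the
  pole.\<close>

lemma spiral_phi_eq_arcsin:
  assumes "1 \<le> k" "k \<le> N"
  shows "spiral_phi N k = 2 * arcsin (sqrt ((2 * real k - 1) / 2) / sqrt (real N))"
proof -
  define s where "s = sqrt ((2 * real k - 1) / 2) / sqrt (real N)"
  have s2: "s\<^sup>2 = (2 * real k - 1) / (2 * real N)"
    using assms by (simp add: s_def power_divide)
  have "s\<^sup>2 \<le> 1\<^sup>2" using assms by (simp add: s2)
  moreover have "0 \<le> s" using assms by (simp add: s_def)
  ultimately have s: "0 \<le> s" "s \<le> 1" using power2_le_imp_le[of s 1] by auto
  have "0 \<le> arcsin s" using arcsin_le_arcsin[of 0 s] s by simp
  moreover have "arcsin s \<le> pi / 2" using arcsin_bounded[of s] s by simp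
  moreover have "cos (2 * arcsin s) = spiral_h N k"
  proof -
    have "cos (2 * arcsin s) = 1 - 2 * s\<^sup>2" using s by (simp add: cos_double_sin)
    also have "\<dots> = spiral_h N k" using assms by (simp add: s2 spiral_h_def field_simps)
    finally show ?thesis .
  qed
  ultimately show ?thesis
    using arccos_cos[of "2 * arcsin s"] by (simp add: spiral_phi_def s_def)
qed

lemma sqrt_mult_spiral_phi_tendsto:
  assumes "1 \<le> k"
  shows "(\<lambda>N. sqrt (real N) * spiral_phi N k) \<longlonglongrightarrow> 2 * sqrt ((2 * real k - 1) / 2)"
proof -
  define c where "c = sqrt ((2 * real k - 1) / 2)"
  have c: "0 < c" using assms by (simp add: c_def)
  have "((\<lambda>x. arcsin x / x) \<longlongrightarrow> 1) (at 0)"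
    using DERIV_arcsin[of 0] by (simp add: has_field_derivative_iff)
  moreover have "filterlim (\<lambda>N. c / sqrt (real N)) (at 0) sequentially"
  proof (rule filterlim_atI)
    have "filterlim (\<lambda>N. sqrt (real N)) at_top sequentially"
      by (intro filterlim_compose[OF sqrt_at_top] filterlim_real_sequentially)
    then show "(\<lambda>N. c / sqrt (real N)) \<longlonglongrightarrow> 0"
      by (intro tendsto_divide_0[OF tendsto_const] filterlim_at_top_imp_at_infinity)
    show "\<forall>\<^sub>F N in sequentially. c / sqrt (real N) \<noteq> 0"
      using eventually_gt_at_top[of 0] by eventually_elim (use c in simp)
  qed
  ultimately have "(\<lambda>N. arcsin (c / sqrt (real N)) / (c / sqrt (real N))) \<longlonglongrightarrow> 1"
    by (rule filterlim_compose)
  then have "(\<lambda>N. 2 * c * (arcsin (c / sqrt (real N)) / (c / sqrt (real N)))) \<longlonglongrightarrow> 2 * c * 1"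
    by (rule tendsto_mult_left)
  moreover have "\<forall>\<^sub>F N in sequentially. 2 * c * (arcsin (c / sqrt (real N)) / (c / sqrt (real N)))
      = sqrt (real N) * spiral_phi N k"
    using eventually_ge_at_top[of k]
    by eventually_elim (use assms c in \<open>simp add: spiral_phi_eq_arcsin c_def[symmetric]\<close>)
  ultimately show ?thesis unfolding c_def by (simp add: tendsto_cong)
qed

lemma half_turn_tendsto: "(\<lambda>N. half_turn N m) \<longlonglongrightarrow> half_turn_limit m"
proof -
  have "(\<lambda>N. sqrt pi * ((sqrt (real N) * spiral_phi N (1 + m) - sqrt (real N) * spiral_phi N 1) / 2))
    \<longlonglongrightarrow> sqrt pi * ((2 * sqrt ((2 * real (1 + m) - 1) / 2) - 2 * sqrt ((2 * real 1 - 1) / 2)) / 2)"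
    by (intro tendsto_intros sqrt_mult_spiral_phi_tendsto) simp_all
  then show ?thesis
    by (simp add: half_turn_def half_turn_limit_def half_gap_def real_sqrt_mult algebra_simps diff_divide_distrib)
qed

lemma half_turn_limit_bounds:
  "0 < half_turn_limit 1" "half_turn_limit 1 < 1" "half_turn_limit 2 < 1.6"
  "half_turn_limit 3 < 2.1" "half_turn_limit 4 < 2.51"
proof -
  have r: "sqrt (1 / 2) \<ge> (0.7071 :: real)" by (rule real_le_rsqrt) (simp add: power2_eq_square)
  have p: "sqrt pi \<le> 1.7725" by (rule real_le_lsqrt; use pi_approx in \<open>simp add: power2_eq_square\<close>)
  have bound: "half_turn_limit m < c"
    if "(2 * real m + 1) / 2 \<le> t\<^sup>2" "0.7071 \<le> t" "1.7725 * (t - 0.7071) < c" for m t c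
  proof -
    have "sqrt ((2 * real m + 1) / 2) - sqrt (1 / 2) \<le> t - 0.7071"
      using r that by (intro diff_mono real_le_lsqrt) auto
    then have "half_turn_limit m \<le> 1.7725 * (t - 0.7071)"
      unfolding half_turn_limit_def using p by (intro mult_mono) auto
    with that show ?thesis by simp
  qed
  show "0 < half_turn_limit 1" by (simp add: half_turn_limit_def)
  \<comment> \<open>The witnesses 1.225, 1.582, 1.871 and 2.1214 are upper approximations of the
    square roots of 3/2, 5/2, 7/2 and 9/2.\<close>
  show "half_turn_limit 1 < 1" by (rule bound[of _ "1.225"]) (simp_all add: power2_eq_square)
  show "half_turn_limit 2 < 1.6" by (rule bound[of _ "1.582"]) (simp_all add: power2_eq_square)
  show "half_turn_limit 3 < 2.1" by (rule bound[of _ "1.871"]) (simp_all add: power2_eq_square)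
  show "half_turn_limit 4 < 2.51" by (rule bound[of _ "2.1214"]) (simp_all add: power2_eq_square)
qed

text \<open>Here \<open>v\<^sup>2 / pi = 2 - sqrt 3\<close> has the reciprocal
  \<open>2 + sqrt 3\<close>, so the two coefficients are conjugate and the double-angle formula
  combines them.\<close>

lemma planar_half_turn_limit:
  "planar 1 (half_turn_limit 1) = 8 - 4 * sqrt 3 * cos (sqrt (2 * pi) * (1 - sqrt 3))"
proof -
  define v where "v = half_turn_limit 1"
  have veq: "v = sqrt (pi / 2) * (sqrt 3 - 1)"
    by (simp add: v_def half_turn_limit_def real_sqrt_divide diff_divide_distrib[symmetric])
  have "v\<^sup>2 = (pi / 2) * (4 - 2 * sqrt 3)"
    unfolding veq by (simp add: power_mult_distrib power2_diff)
  then have v2: "v\<^sup>2 / pi = 2 - sqrt 3" by (simp add: field_simps)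
  have "(2 - sqrt 3) * (2 + sqrt 3) = (1::real)" by (simp add: algebra_simps)
  then have inv: "4 * (1::real)\<^sup>2 / (2 - sqrt 3) = 4 * (2 + sqrt 3)"
    using real_less_lsqrt[of 2 3] by (subst divide_eq_eq) (auto simp: algebra_simps)
  have "sqrt (2 * pi) = 2 * sqrt (pi / 2)"
    using real_sqrt_mult[of 4 "pi / 2"] by simp
  then have "cos (sqrt (2 * pi) * (1 - sqrt 3)) = cos (2 * v)"
    unfolding veq by (subst cos_minus[symmetric]) (simp add: algebra_simps)
  also have "\<dots> = (cos v)\<^sup>2 - (sin v)\<^sup>2" by (rule cos_double)
  finally have c: "cos (sqrt (2 * pi) * (1 - sqrt 3)) = (cos v)\<^sup>2 - (sin v)\<^sup>2" .
  have "planar 1 v = 4 * (2 - sqrt 3) * (cos v)\<^sup>2 + 4 * (2 + sqrt 3) * (sin v)\<^sup>2"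
    unfolding planar_def v2 of_nat_1 inv ..
  also have "\<dots> = 8 - 4 * sqrt 3 * ((cos v)\<^sup>2 - (sin v)\<^sup>2)"
    unfolding sin_squared_eq by algebra
  finally show ?thesis by (simp add: c v_def)
qed

text \<open>
  A lower bound for \<open>sin w / w\<close> when \<open>L w \<le> 2.8\<close>, from \<open>sin w \<ge> w - w\<^sup>3 / 6\<close>. Beyond \<open>L w = 2.8\<close> the
  polar distance alone suffices, as \<open>4 \<sdot> 2.8\<^sup>2 / \<pi> > 9.9\<close>, while the square of the claimed limit is
  about \<open>9.809\<close>.
\<close>

definition chord_factor :: "nat \<Rightarrow> real" where
  "chord_factor N = 1 - 2.8\<^sup>2 / (6 * (real N * pi))"

lemma chord_factor_tendsto: "chord_factor \<longlonglongrightarrow> 1"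
proof -
  have "(\<lambda>N. 1 - 2.8\<^sup>2 / (6 * pi) * (1 / real N)) \<longlonglongrightarrow> 1 - 2.8\<^sup>2 / (6 * pi) * 0"
    by (intro tendsto_intros lim_1_over_n)
  then show ?thesis by (simp add: chord_factor_def[abs_def] mult_ac)
qed

text \<open>Since \<open>v\<^sup>2 / pi = N * w\<^sup>2\<close>, this compares \<open>sin w\<close>
  with \<open>w\<close>; the upper bound is \<open>sin w \<le> w\<close>.\<close>

lemma chord_bounds:
  assumes "0 < N" "0 \<le> w" "sqrt (real N * pi) * w \<le> 2.8" "0 \<le> chord_factor N"
  defines "v \<equiv> sqrt (real N * pi) * w"
  shows "(chord_factor N)\<^sup>2 * (v\<^sup>2 / pi) \<le> real N * (sin w)\<^sup>2" "real N * (sin w)\<^sup>2 \<le> v\<^sup>2 / pi"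
proof -
  have v2: "v\<^sup>2 = real N * pi * w\<^sup>2" by (simp add: v_def power_mult_distrib)
  have "v\<^sup>2 \<le> 2.8\<^sup>2" using assms by (intro power_mono) auto
  then have "w\<^sup>2 \<le> 2.8\<^sup>2 / (real N * pi)"
    using assms(1) by (simp add: v2 field_simps)
  then have "chord_factor N \<le> 1 - w\<^sup>2 / 6" by (simp add: chord_factor_def)
  then have "chord_factor N * w \<le> (1 - w\<^sup>2 / 6) * w" using assms by (intro mult_right_mono) auto
  also have "\<dots> = w - w ^ 3 / 6" by (simp add: power2_eq_square power3_eq_cube algebra_simps)
  also have "\<dots> \<le> sin w" using assms by (intro sin_ge_cubic)
  finally have lo: "chord_factor N * w \<le> sin w" .
  then have "(chord_factor N * w)\<^sup>2 \<le> (sin w)\<^sup>2" using assms by (intro power_mono) auto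
  then have "real N * (chord_factor N * w)\<^sup>2 \<le> real N * (sin w)\<^sup>2" by (intro mult_left_mono) auto
  then show "(chord_factor N)\<^sup>2 * (v\<^sup>2 / pi) \<le> real N * (sin w)\<^sup>2"
    by (simp add: v2 power_mult_distrib mult_ac)
  have "0 \<le> sin w" using lo assms mult_nonneg_nonneg[of "chord_factor N" w] by linarith
  then have "(sin w)\<^sup>2 \<le> w\<^sup>2" using assms sin_x_le_x[of w] by (intro power_mono) auto
  then have "real N * (sin w)\<^sup>2 \<le> real N * w\<^sup>2" by (intro mult_left_mono) auto
  then show "real N * (sin w)\<^sup>2 \<le> v\<^sup>2 / pi" by (simp add: v2)
qed

text \<open>For \<open>v \<le> 2.8\<close> the exact distance is at least \<open>planar m v\<close>
  up to the squared chord factor; \<open>m = 1\<close> is then settled by monotonicity,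
  \<open>m \<ge> 2\<close> by the threshold 9.9. For larger \<open>v\<close> the polar part
  suffices.\<close>

lemma dist_spiral_point_lower_bound:
  assumes jk: "1 \<le> j" "j < k" "k \<le> N" and q: "0 \<le> chord_factor N"
    and ht: "half_turn N 1 \<le> 1" "half_turn N 2 \<le> 1.6" "half_turn N 3 \<le> 2.1" "half_turn N 4 \<le> 2.51"
  shows "(chord_factor N)\<^sup>2 * min (planar 1 (half_turn N 1)) 9.9
     \<le> real N * (dist (spiral_point N j) (spiral_point N k))\<^sup>2"
proof -
  define w where "w = half_gap N j k"
  define m where "m = k - j"
  define v where "v = sqrt (real N * pi) * w"
  define d where "d = real N * (dist (spiral_point N j) (spiral_point N k))\<^sup>2"
  have N: "0 < N" using jk by simp
  have w: "0 < w" "w \<le> pi / 2" using half_gap_bounds[OF jk] by (simp_all add: w_def)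
  have v: "0 < v" using w N by (simp add: v_def)
  have m: "1 \<le> m" using jk by (simp add: m_def)
  have vm: "v \<le> half_turn N m"
    using half_gap_le_polar_gap[of j m N] jk m N
    by (simp add: v_def w_def m_def half_turn_def)
  have q1: "chord_factor N \<le> 1" by (simp add: chord_factor_def)
  show ?thesis
  proof (cases "v \<le> 2.8")
    case True
    note cb = chord_bounds[OF N _ True[unfolded v_def] q, folded v_def]
    have S: "0 < real N * (sin w)\<^sup>2" using w N sin_gt_zero[of w] by simp
    have "d = 4 * (real N * (sin w)\<^sup>2) * (cos v)\<^sup>2 + 4 * (real m)\<^sup>2 / (real N * (sin w)\<^sup>2) * (sin v)\<^sup>2"
      unfolding d_def m_def v_def w_def by (rule dist_spiral_point[OF jk])
    moreover have "4 * ((chord_factor N)\<^sup>2 * (v\<^sup>2 / pi)) * (cos v)\<^sup>2 \<le> 4 * (real N * (sin w)\<^sup>2) * (cos v)\<^sup>2"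
      using cb w by (intro mult_right_mono mult_left_mono) auto
    \<comment> \<open>In the denominator the replacement by \<open>v\<^sup>2 / pi\<close> only
      lowers the term; the chord factor is needed for the cosine term alone.\<close>
    moreover have "4 * (real m)\<^sup>2 / (v\<^sup>2 / pi) * (sin v)\<^sup>2 \<le> 4 * (real m)\<^sup>2 / (real N * (sin w)\<^sup>2) * (sin v)\<^sup>2"
      using cb w S v by (intro mult_right_mono divide_left_mono) auto
    moreover have "(chord_factor N)\<^sup>2 * (4 * (real m)\<^sup>2 / (v\<^sup>2 / pi) * (sin v)\<^sup>2)
        \<le> 1 * (4 * (real m)\<^sup>2 / (v\<^sup>2 / pi) * (sin v)\<^sup>2)"
      using q q1 by (intro mult_right_mono) (auto simp: power_le_one)
    ultimately have "(chord_factor N)\<^sup>2 * planar m v \<le> d"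
      by (simp add: planar_def distrib_left mult_ac)
    moreover have "min (planar 1 (half_turn N 1)) 9.9 \<le> planar m v"
    proof (cases "m = 1")
      case True
      then have "planar 1 (half_turn N 1) \<le> planar 1 v"
        using v vm ht by (intro planar_1_antimono) auto
      then show ?thesis using True by simp
    next
      case False
      then have "9.9 \<le> planar m v"
        using v vm ht m \<open>v \<le> 2.8\<close> by (intro planar_ge) auto
      then show ?thesis by simp
    qed
    ultimately show ?thesis
      using mult_left_mono[of "min (planar 1 (half_turn N 1)) 9.9" "planar m v" "(chord_factor N)\<^sup>2"]
      by (simp add: d_def)
  next
    case False
    \<comment> \<open>\<open>w0\<close> is the half gap at which \<open>v\<close> would equal 2.8.
      The chord bound holds there and the sine increases from \<open>w0\<close> to
      \<open>w\<close>.\<close>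
    define w0 where "w0 = 2.8 / sqrt (real N * pi)"
    have w0: "0 \<le> w0" "sqrt (real N * pi) * w0 = 2.8" using N by (simp_all add: w0_def)
    have "w0 \<le> w" using False N by (simp add: v_def w0_def field_simps)
    then have "sin w0 \<le> sin w" "0 \<le> sin w0" using w w0
      by (auto intro!: sin_monotone_2pi_le sin_ge_zero)
    then have "(sin w0)\<^sup>2 \<le> (sin w)\<^sup>2" by (intro power_mono)
    have "9.9 \<le> 4 * (2.8\<^sup>2 / pi)" using pi_approx by (simp add: le_divide_eq power2_eq_square)
    then have "min (planar 1 (half_turn N 1)) 9.9 \<le> 4 * (2.8\<^sup>2 / pi)" by simp
    then have "(chord_factor N)\<^sup>2 * min (planar 1 (half_turn N 1)) 9.9 \<le> (chord_factor N)\<^sup>2 * (4 * (2.8\<^sup>2 / pi))"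
      by (intro mult_left_mono) auto
    also have "\<dots> = 4 * ((chord_factor N)\<^sup>2 * (2.8\<^sup>2 / pi))" by simp
    also have "\<dots> \<le> 4 * (real N * (sin w0)\<^sup>2)"
      using chord_bounds(1)[OF N w0(1) _ q] w0(2) by simp
    also have "\<dots> \<le> 4 * (real N * (sin w)\<^sup>2)"
      using \<open>(sin w0)\<^sup>2 \<le> (sin w)\<^sup>2\<close> by (intro mult_left_mono) auto
    also have "\<dots> \<le> d" unfolding d_def w_def by (rule dist_spiral_point_ge[OF jk])
    finally show ?thesis by (simp add: d_def)
  qed
qed

text \<open>The chord bounds squeeze \<open>S N\<close> to \<open>A\<^sup>2 / pi\<close>, which
  turns the exact distance formula into the planar one.\<close>

lemma dist_first_two_tendsto:
  "(\<lambda>N. real N * (dist (spiral_point N 1) (spiral_point N 2))\<^sup>2) \<longlonglongrightarrow> planar 1 (half_turn_limit 1)"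
proof -
  define A where "A = half_turn_limit 1"
  have A: "0 < A" "A < 1" using half_turn_limit_bounds by (simp_all add: A_def)
  define S where "S N = real N * (sin (half_gap N 1 2))\<^sup>2" for N
  note v = half_turn_tendsto[of 1, folded A_def]
  have ev: "\<forall>\<^sub>F N in sequentially. 2 \<le> N \<and> half_turn N 1 < 1 \<and> 0 < chord_factor N"
    using eventually_ge_at_top[of "2::nat"] order_tendstoD(2)[OF v A(2)]
      order_tendstoD(1)[OF chord_factor_tendsto zero_less_one]
    by eventually_elim simp
  have "S \<longlonglongrightarrow> A\<^sup>2 / pi"
  proof (rule tendsto_sandwich)
    show "(\<lambda>N. (chord_factor N)\<^sup>2 * ((half_turn N 1)\<^sup>2 / pi)) \<longlonglongrightarrow> A\<^sup>2 / pi"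
      using tendsto_mult[OF tendsto_power[OF chord_factor_tendsto, of 2] tendsto_divide[OF tendsto_power[OF v, of 2] tendsto_const, of pi]]
      by simp
    show "(\<lambda>N. (half_turn N 1)\<^sup>2 / pi) \<longlonglongrightarrow> A\<^sup>2 / pi"
      by (intro tendsto_intros v) simp
    show "\<forall>\<^sub>F N in sequentially. (chord_factor N)\<^sup>2 * ((half_turn N 1)\<^sup>2 / pi) \<le> S N"
      using ev
    proof eventually_elim
      case (elim N)
      then show ?case
        using chord_bounds(1)[of N "half_gap N 1 2"] half_gap_bounds[of 1 2 N]
        by (simp add: S_def half_turn_def numeral_2_eq_2)
    qed
    show "\<forall>\<^sub>F N in sequentially. S N \<le> (half_turn N 1)\<^sup>2 / pi"
      using ev
    proof eventually_elim
      case (elim N)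
      then show ?case
        using chord_bounds(2)[of N "half_gap N 1 2"] half_gap_bounds[of 1 2 N]
        by (simp add: S_def half_turn_def numeral_2_eq_2)
    qed
  qed
  then have "(\<lambda>N. 4 * S N * (cos (half_turn N 1))\<^sup>2 + 4 * (real 1)\<^sup>2 / S N * (sin (half_turn N 1))\<^sup>2) \<longlonglongrightarrow> planar 1 A"
    unfolding planar_def using v A by (intro tendsto_intros) auto
  moreover have "\<forall>\<^sub>F N in sequentially. 4 * S N * (cos (half_turn N 1))\<^sup>2 + 4 * (real 1)\<^sup>2 / S N * (sin (half_turn N 1))\<^sup>2
     = real N * (dist (spiral_point N 1) (spiral_point N 2))\<^sup>2"
    using ev
  proof eventually_elim
    case (elim N)
    then show ?case
      using dist_spiral_point[of 1 2 N] by (simp add: S_def half_turn_def numeral_2_eq_2)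
  qed
  ultimately show ?thesis by (simp add: tendsto_cong A_def)
qed

lemma separation_spiral_points:
  assumes "2 \<le> N"
  shows "separation (spiral_points N) \<le> dist (spiral_point N 1) (spiral_point N 2)"
    and "\<exists>j k. 1 \<le> j \<and> j < k \<and> k \<le> N \<and> separation (spiral_points N) = dist (spiral_point N j) (spiral_point N k)"
proof -
  define D where "D = {dist x y | x y. x \<in> spiral_points N \<and> y \<in> spiral_points N \<and> x \<noteq> y}"
  have "D \<subseteq> (\<lambda>(x, y). dist x y) ` (spiral_points N \<times> spiral_points N)"
    by (auto simp: D_def)
  then have fin: "finite D" by (rule finite_subset) (simp add: spiral_points_eq)
  have "spiral_point N 1 \<noteq> spiral_point N 2"
    using inj_on_spiral_point[of N] assms by (auto dest: inj_onD)
  then have D12: "dist (spiral_point N 1) (spiral_point N 2) \<in> D"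
    using assms unfolding D_def spiral_points_eq by force
  then show "separation (spiral_points N) \<le> dist (spiral_point N 1) (spiral_point N 2)"
    using fin unfolding separation_def D_def[symmetric] by simp
  have "separation (spiral_points N) \<in> D"
    unfolding separation_def D_def[symmetric] using fin D12 by (intro Min_in) auto
  then obtain j k where jk: "j \<in> {1..N}" "k \<in> {1..N}" "spiral_point N j \<noteq> spiral_point N k"
      "separation (spiral_points N) = dist (spiral_point N j) (spiral_point N k)"
    by (auto simp: D_def spiral_points_eq)
  then consider "j < k" | "k < j" by (metis linorder_neqE_nat)
  then show "\<exists>j k. 1 \<le> j \<and> j < k \<and> k \<le> N \<and> separation (spiral_points N) = dist (spiral_point N j) (spiral_point N k)"
    using jk by cases (auto simp: dist_commute[of "spiral_point N j"], (metis dist_commute)?)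
qed

text \<open>A sandwich between the uniform lower bound over all pairs and the distance of the first
  two points. As the limit is below 9.9, the minimum in the lower bound has the same limit.\<close>

lemma separation_tendsto:
  "(\<lambda>N. sqrt (real N) * separation (spiral_points N))
     \<longlonglongrightarrow> sqrt (8 - 4 * sqrt 3 * cos (sqrt (2 * pi) * (1 - sqrt 3)))"
proof -
  define D where "D = 8 - 4 * sqrt 3 * cos (sqrt (2 * pi) * (1 - sqrt 3))"
  have D: "planar 1 (half_turn_limit 1) = D" unfolding D_def by (rule planar_half_turn_limit)
  have "isCont (planar 1) (half_turn_limit 1)"
    unfolding planar_def using half_turn_limit_bounds(1) by (intro continuous_intros) auto
  then have "(\<lambda>N. planar 1 (half_turn N 1)) \<longlonglongrightarrow> D"
    unfolding D[symmetric] using half_turn_tendsto by (rule isCont_tendsto_compose)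
  then have "(\<lambda>N. (chord_factor N)\<^sup>2 * min (planar 1 (half_turn N 1)) 9.9) \<longlonglongrightarrow> 1\<^sup>2 * min D 9.9"
    by (intro tendsto_intros chord_factor_tendsto)
  then have lower: "(\<lambda>N. (chord_factor N)\<^sup>2 * min (planar 1 (half_turn N 1)) 9.9) \<longlonglongrightarrow> D"
    using separation_constant_bounds(2) by (simp add: D_def)
  have ht: "\<forall>\<^sub>F N in sequentially. half_turn N m < c" if "half_turn_limit m < c" for m c
    using half_turn_tendsto that by (rule order_tendstoD(2))
  have "(\<lambda>N. real N * (separation (spiral_points N))\<^sup>2) \<longlonglongrightarrow> D"
  proof (rule tendsto_sandwich[OF _ _ lower dist_first_two_tendsto[unfolded D]])
    show "\<forall>\<^sub>F N in sequentially. (chord_factor N)\<^sup>2 * min (planar 1 (half_turn N 1)) 9.9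
        \<le> real N * (separation (spiral_points N))\<^sup>2"
      using eventually_ge_at_top[of 2] order_tendstoD(1)[OF chord_factor_tendsto zero_less_one]
        ht[OF half_turn_limit_bounds(2)] ht[OF half_turn_limit_bounds(3)]
        ht[OF half_turn_limit_bounds(4)] ht[OF half_turn_limit_bounds(5)]
    proof eventually_elim
      case (elim N)
      obtain j k where "1 \<le> j" "j < k" "k \<le> N" "separation (spiral_points N) = dist (spiral_point N j) (spiral_point N k)"
        using separation_spiral_points(2)[OF elim(1)] by blast
      then show ?case using dist_spiral_point_lower_bound[of j k N] elim by auto
    qed
    show "\<forall>\<^sub>F N in sequentially. real N * (separation (spiral_points N))\<^sup>2
        \<le> real N * (dist (spiral_point N 1) (spiral_point N 2))\<^sup>2"
      using eventually_ge_at_top[of 2]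
    proof eventually_elim
      case (elim N)
      have "0 \<le> separation (spiral_points N)"
        using separation_spiral_points(2)[OF elim] by force
      then show ?case
        using separation_spiral_points(1)[OF elim] by (intro mult_left_mono power_mono) auto
    qed
  qed
  then have "(\<lambda>N. sqrt (real N * (separation (spiral_points N))\<^sup>2)) \<longlonglongrightarrow> sqrt D"
    by (rule tendsto_real_sqrt)
  moreover have "\<forall>\<^sub>F N in sequentially. sqrt (real N * (separation (spiral_points N))\<^sup>2)
      = sqrt (real N) * separation (spiral_points N)"
    using eventually_ge_at_top[of 2]
  proof eventually_elim
    case (elim N)
    have "0 \<le> separation (spiral_points N)"
      using separation_spiral_points(2)[OF elim] by force
    then show ?case by (simp add: real_sqrt_mult)
  qed
  ultimately show ?thesis by (simp add: tendsto_cong D_def)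
qed

section \<open>The covering radius\<close>

text \<open>The spiral heights are the midpoints of \<open>N\<close> intervals of length
  \<open>2 / N\<close> that fill \<open>[-1, 1]\<close>.\<close>

lemma ex_spiral_h_close:
  assumes "1 \<le> N" "-1 \<le> h" "h \<le> 1"
  shows "\<exists>k. 1 \<le> k \<and> k \<le> N \<and> \<bar>h - spiral_h N k\<bar> \<le> 1 / real N"
\<comment> \<open>At \<open>h = -1\<close> the floor formula for \<open>k\<close> would give
  \<open>N + 1\<close>.\<close>
proof (cases "h = -1")
  case True
  then show ?thesis
    using assms by (intro exI[of _ N]) (simp add: spiral_h_def field_simps)
next
  case False
  define t where "t = real N * (1 - h) / 2"
  define k where "k = nat \<lfloor>t\<rfloor> + 1"
  have "real N * (1 - h) < real N * 2" using assms False by (intro mult_strict_left_mono) auto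
  then have t: "0 \<le> t" "t < real N" using assms by (simp_all add: t_def)
  have kt: "real k - 1 \<le> t" "t \<le> real k" using t by (simp_all add: k_def) linarith+
  have "k \<le> N" using kt(1) t(2) by linarith
  moreover have "h = 1 - 2 * t / real N" using assms by (simp add: t_def field_simps)
  then have "h - spiral_h N k = (2 * (real k - t) - 1) / real N"
    using assms by (simp add: spiral_h_def field_simps)
  then have "\<bar>h - spiral_h N k\<bar> = \<bar>2 * (real k - t) - 1\<bar> / real N" by simp
  then have "\<bar>h - spiral_h N k\<bar> \<le> 1 / real N"
    using kt by (simp add: divide_right_mono abs_le_iff)
  ultimately show ?thesis by (intro exI[of _ k]) (simp add: k_def)
qed

lemma S2_eq_sph_point:
  assumes "y \<in> S2"
  shows "\<exists>\<phi> \<theta>. 0 \<le> \<phi> \<and> \<phi> \<le> pi \<and> 0 \<le> \<theta> \<and> \<theta> < 2 * pi \<and> y = sph_point \<phi> \<theta>"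
proof -
  have "(norm y)\<^sup>2 = 1" using assms by simp
  then have y: "(y $ 1)\<^sup>2 + (y $ 2)\<^sup>2 + (y $ 3)\<^sup>2 = 1"
    using dist_real3[of y 0] by simp
  then have "(y $ 3)\<^sup>2 \<le> 1\<^sup>2" using zero_le_power2[of "y $ 1"] zero_le_power2[of "y $ 2"] by (simp only: one_power2)
  then have y3: "-1 \<le> y $ 3" "y $ 3 \<le> 1" by (simp_all add: abs_square_le_1 abs_le_iff)
  define \<phi> where "\<phi> = arccos (y $ 3)"
  have \<phi>: "0 \<le> \<phi>" "\<phi> \<le> pi" "cos \<phi> = y $ 3"
    using y3 arccos_bounded by (auto simp: \<phi>_def)
  have s: "(sin \<phi>)\<^sup>2 = (y $ 1)\<^sup>2 + (y $ 2)\<^sup>2" "0 \<le> sin \<phi>"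
    using y \<phi> by (auto simp: sin_squared_eq intro!: sin_ge_zero)
  have "\<exists>\<theta>. 0 \<le> \<theta> \<and> \<theta> < 2 * pi \<and> y $ 1 = sin \<phi> * cos \<theta> \<and> y $ 2 = sin \<phi> * sin \<theta>"
  proof (cases "sin \<phi> = 0")
    case True
    then have "y $ 1 = 0" "y $ 2 = 0" using s by (simp_all add: sum_power2_eq_zero_iff)
    then show ?thesis using True by (intro exI[of _ 0]) simp
  next
    case False
    have "(y $ 1 / sin \<phi>)\<^sup>2 + (y $ 2 / sin \<phi>)\<^sup>2 = 1"
      using False by (simp add: power_divide add_divide_distrib[symmetric] s(1)[symmetric])
    then obtain \<theta> where "0 \<le> \<theta>" "\<theta> < 2 * pi" "y $ 1 / sin \<phi> = cos \<theta>" "y $ 2 / sin \<phi> = sin \<theta>"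
      using sincos_total_2pi by blast
    then show ?thesis using False by (intro exI[of _ \<theta>]) (simp add: field_simps)
  qed
  then obtain \<theta> where "0 \<le> \<theta>" "\<theta> < 2 * pi" "y $ 1 = sin \<phi> * cos \<theta>" "y $ 2 = sin \<phi> * sin \<theta>" by blast
  moreover from this have "y = sph_point \<phi> \<theta>"
    by (simp add: vec_eq_iff forall_3 sph_point_component \<phi>)
  ultimately show ?thesis using \<phi> by blast
qed

lemma sph_point_periodic:
  "sph_point \<phi> (\<theta> + 2 * pi * of_int n) = sph_point \<phi> \<theta>"
proof -
  have "sin (\<theta> + 2 * pi * of_int n) = sin \<theta>" "cos (\<theta> + 2 * pi * of_int n) = cos \<theta>"
    using sin.plus_of_int[of \<theta> n] cos.plus_of_int[of \<theta> n] by (simp_all add: mult_ac)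
  then show ?thesis by (simp add: sph_point_def)
qed

text \<open>Two moves of length at most \<open>4 / sqrt N\<close>: along the meridian of
  \<open>y\<close> to a nearby turn of the spiral, then to a spiral point whose height is within
  \<open>1 / N\<close>.\<close>

lemma ex_spiral_point_close:
  assumes N: "4 \<le> N" and y: "y \<in> S2"
  shows "\<exists>k. 1 \<le> k \<and> k \<le> N \<and> dist (spiral_point N k) y \<le> 8 / sqrt (real N)"
proof -
  obtain \<phi> \<theta> where \<phi>: "0 \<le> \<phi>" "\<phi> \<le> pi" and \<theta>: "0 \<le> \<theta>" "\<theta> < 2 * pi" and y_eq: "y = sph_point \<phi> \<theta>"
    using S2_eq_sph_point[OF y] by blast
  define L where "L = sqrt (real N * pi)"
  have L: "2 \<le> L" 
    unfolding L_def using N pi_gt3 mult_mono[of 4 "real N" 1 pi] by (intro real_le_rsqrt) simp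
  have "\<exists>n::int. 0 \<le> \<theta> + 2 * pi * of_int n \<and> \<theta> + 2 * pi * of_int n \<le> L * pi
      \<and> \<bar>\<theta> + 2 * pi * of_int n - L * \<phi>\<bar> \<le> 2 * pi"
  proof -
    define n where "n = \<lfloor>(L * \<phi> - \<theta>) / (2 * pi)\<rfloor>"
    have "of_int n \<le> (L * \<phi> - \<theta>) / (2 * pi)" "(L * \<phi> - \<theta>) / (2 * pi) < of_int n + 1"
      by (simp_all add: n_def)
    then have n: "2 * pi * of_int n \<le> L * \<phi> - \<theta>" "L * \<phi> - \<theta> < 2 * pi * of_int n + 2 * pi"
      by (simp_all add: field_simps)
    have LP: "L * \<phi> \<le> L * pi" "0 \<le> L * \<phi>" "2 * pi \<le> L * pi" using L \<phi> by auto
    show ?thesis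
    proof (cases "0 \<le> n")
      case True
      then have "0 \<le> 2 * pi * of_int n" by simp
      then show ?thesis using n LP \<theta> by (intro exI[of _ n] conjI; linarith)
    next
      \<comment> \<open>Here \<open>y\<close> lies before the first crossing of its meridian by the
        spiral, so that first crossing, with \<open>n = 0\<close>, is taken.\<close>
      case False
      then have "2 * pi * of_int n \<le> 2 * pi * (-1)" by (intro mult_left_mono) auto
      then show ?thesis using n LP \<theta> by (intro exI[of _ 0] conjI; simp; linarith)
    qed
  qed
  then obtain n :: int where n: "0 \<le> \<theta> + 2 * pi * of_int n" "\<theta> + 2 * pi * of_int n \<le> L * pi"
      "\<bar>\<theta> + 2 * pi * of_int n - L * \<phi>\<bar> \<le> 2 * pi" by blast
  define a where "a = (\<theta> + 2 * pi * of_int n) / L"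
  have La: "L * a = \<theta> + 2 * pi * of_int n" using L by (simp add: a_def)
  have a: "0 \<le> a" "a \<le> pi" using n L by (simp_all add: a_def divide_le_eq mult.commute)
  have "L * \<bar>a - \<phi>\<bar> \<le> 2 * pi"
    using n(3) L by (simp add: La[symmetric] right_diff_distrib[symmetric] abs_mult)
  then have "\<bar>a - \<phi>\<bar> \<le> 2 * pi / L" using L by (simp add: field_simps)
  also have "2 * pi / L = 2 * sqrt pi / sqrt (real N)"
    using N by (simp add: L_def real_sqrt_mult field_simps)
  also have "\<dots> \<le> 4 / sqrt (real N)"
  proof -
    have "sqrt pi \<le> 2" by (rule real_le_lsqrt) (use pi_less_4 in auto)
    then show ?thesis by (intro divide_right_mono) auto
  qed
  finally have "dist (sph_point a (L * a)) y \<le> 4 / sqrt (real N)"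
    using sph_point_lipschitz_polar[of a \<theta> \<phi>] by (simp add: y_eq La sph_point_periodic)
  moreover obtain k where k: "1 \<le> k" "k \<le> N" "\<bar>cos a - spiral_h N k\<bar> \<le> 1 / real N"
    using ex_spiral_h_close[of N "cos a"] N by auto
  have "dist (sph_point a (L * a)) (spiral_point N k) \<le> 4 / sqrt (real N)"
    unfolding L_def by (rule dist_spiral_curve[OF k(1,2) a k(3)])
  ultimately have "dist (spiral_point N k) y \<le> 4 / sqrt (real N) + 4 / sqrt (real N)"
    using dist_triangle3[of "spiral_point N k" y "sph_point a (L * a)"] by linarith
  then show ?thesis using k by (intro exI[of _ k]) simp
qed

lemma covering_radius_nonneg:
  assumes "finite \<omega>" "\<omega> \<noteq> {}"
  shows "0 \<le> covering_radius \<omega>"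
proof -
  obtain x where x: "x \<in> \<omega>" using assms by blast
  \<comment> \<open>Without an upper bound the real supremum would be unspecified.\<close>
  have "bdd_above ((\<lambda>y. Min ((\<lambda>x. dist x y) ` \<omega>)) ` S2)"
  proof (rule bdd_aboveI2)
    fix y :: "real ^ 3" assume "y \<in> S2"
    have "Min ((\<lambda>x. dist x y) ` \<omega>) \<le> dist x y" using assms x by (intro Min_le) auto
    also have "\<dots> \<le> norm x + norm y" by (simp add: dist_norm norm_triangle_ineq4)
    finally show "Min ((\<lambda>x. dist x y) ` \<omega>) \<le> norm x + 1" using \<open>y \<in> S2\<close> by simp
  qed
  moreover have "0 \<le> Min ((\<lambda>x. dist x (sph_point 0 0)) ` \<omega>)"
    using assms by simp
  ultimately show ?thesis
    unfolding covering_radius_def using sph_point_in_S2 by (intro cSUP_upper2)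
qed

lemma covering_radius_spiral_points:
  assumes "4 \<le> N"
  shows "covering_radius (spiral_points N) \<le> 8 / sqrt (real N)"
  unfolding covering_radius_def
proof (rule cSUP_least)
  show "S2 \<noteq> {}" using sph_point_in_S2 by blast
  fix y assume "y \<in> S2"
  then obtain k where k: "1 \<le> k" "k \<le> N" "dist (spiral_point N k) y \<le> 8 / sqrt (real N)"
    using ex_spiral_point_close[OF assms] by blast
  have "Min ((\<lambda>x. dist x y) ` spiral_points N) \<le> dist (spiral_point N k) y"
    using k by (intro Min_le) (auto simp: spiral_points_eq)
  with k show "Min ((\<lambda>x. dist x y) ` spiral_points N) \<le> 8 / sqrt (real N)" by simp
qed

text \<open>Eventually \<open>sqrt N\<close> times the separation exceeds 1, its limit being about
  3.13, while the covering radius is at most \<open>8 / sqrt N\<close>; the ratio is then at most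
  8.\<close>

lemma quasi_uniform_spiral_points: "quasi_uniform spiral_points"
proof -
  have "1 < x" if "\<bar>x - 3.131948\<bar> \<le> 5 / 10 ^ 7" for x :: real
    using that by (simp add: abs_if split: if_splits)
  from this[OF separation_constant_bounds(1)]
  have "1 < sqrt (8 - 4 * sqrt 3 * cos (sqrt (2 * pi) * (1 - sqrt 3)))" .
  then have "\<forall>\<^sub>F N in sequentially. 1 < sqrt (real N) * separation (spiral_points N)"
    using separation_tendsto by (rule order_tendstoD(1)[rotated])
  then have "\<forall>\<^sub>F N in sequentially. 1 < sqrt (real N) * separation (spiral_points N) \<and> 4 \<le> N"
    using eventually_ge_at_top by (rule eventually_conj)
  then obtain M where M: "\<And>N. M \<le> N \<Longrightarrow> 1 < sqrt (real N) * separation (spiral_points N) \<and> 4 \<le> N"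
    by (auto simp: eventually_sequentially)
  have "norm (mesh_ratio (spiral_points N)) \<le> 8" if "M \<le> N" for N
  proof -
    define s where "s = separation (spiral_points N)"
    have N: "4 \<le> N" "0 < sqrt (real N)" and s: "1 < sqrt (real N) * s"
      using M[OF that] by (auto simp: s_def)
    have s0: "0 < s" using zero_less_mult_pos[of "sqrt (real N)" s] s N by linarith
    have c: "0 \<le> covering_radius (spiral_points N)"
      using N by (intro covering_radius_nonneg) (auto simp: spiral_points_eq)
    have "covering_radius (spiral_points N) \<le> 8 / sqrt (real N)"
      using N by (intro covering_radius_spiral_points)
    also have "\<dots> \<le> 8 * s" using s N by (simp add: field_simps)
    finally show ?thesis using c s0 by (simp add: mesh_ratio_def s_def[symmetric] divide_le_eq)
  qed
  then have "bounded ((\<lambda>N. mesh_ratio (spiral_points N)) ` {M..})"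
    unfolding bounded_iff by auto
  \<comment> \<open>Finitely many further indices do not affect boundedness.\<close>
  then have "bounded ((\<lambda>N. mesh_ratio (spiral_points N)) ` ({..<M} \<union> {M..}))"
    unfolding image_Un bounded_Un by (simp add: finite_imp_bounded)
  then have "bounded ((\<lambda>N. mesh_ratio (spiral_points N)) ` {2..})"
    by (rule bounded_subset) auto
  then show ?thesis by (simp add: quasi_uniform_def config_seq_spiral_points)
qed

section \<open>Integration on the sphere\<close>

text \<open>In the standard basis the rules for continuity and derivatives apply directly.\<close>

lemma sph_point_axis:
  "sph_point \<phi> \<theta> = (sin \<phi> * cos \<theta>) *\<^sub>R axis 1 1 + (sin \<phi> * sin \<theta>) *\<^sub>R axis 2 1 + cos \<phi> *\<^sub>R axis 3 1"
  by (simp add: vec_eq_iff forall_3 sph_point_component axis_def)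

lemma continuous_on_sph_point [continuous_intros]:
  fixes f g :: "'a::t2_space \<Rightarrow> real"
  assumes "continuous_on A f" "continuous_on A g"
  shows "continuous_on A (\<lambda>x. sph_point (f x) (g x))"
  unfolding sph_point_axis by (intro continuous_intros assms)

lemma vector_derivative_sph_point_polar:
  "vector_derivative (\<lambda>u. sph_point u \<theta>) (at \<phi>) =
     (cos \<phi> * cos \<theta>) *\<^sub>R axis 1 1 + (cos \<phi> * sin \<theta>) *\<^sub>R axis 2 1 + (- sin \<phi>) *\<^sub>R axis 3 1"
  unfolding sph_point_axis
  by (rule vector_derivative_at)
     (auto intro!: derivative_eq_intros simp: has_vector_derivative_def algebra_simps)

lemma vector_derivative_sph_point_azimuth:
  "vector_derivative (\<lambda>v. sph_point \<phi> v) (at \<theta>) =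
     (- (sin \<phi> * sin \<theta>)) *\<^sub>R axis 1 1 + (sin \<phi> * cos \<theta>) *\<^sub>R axis 2 1"
  unfolding sph_point_axis
  by (rule vector_derivative_at)
     (auto intro!: derivative_eq_intros simp: has_vector_derivative_def algebra_simps)

text \<open>The cross product is \<open>sin \<phi>\<close> times the radial unit vector.\<close>

lemma area_element_sph_point:
  "norm (cross3 (vector_derivative (\<lambda>u. sph_point u \<theta>) (at \<phi>))
     (vector_derivative (\<lambda>v. sph_point \<phi> v) (at \<theta>))) = \<bar>sin \<phi>\<bar>"
proof -
  let ?c = "cross3 (vector_derivative (\<lambda>u. sph_point u \<theta>) (at \<phi>))
     (vector_derivative (\<lambda>v. sph_point \<phi> v) (at \<theta>))"
  have "(norm ?c)\<^sup>2 = (?c $ 1)\<^sup>2 + (?c $ 2)\<^sup>2 + (?c $ 3)\<^sup>2"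
    using dist_real3[of ?c 0] by simp
  moreover have "?c $ 1 = (sin \<phi>)\<^sup>2 * cos \<theta>" "?c $ 2 = (sin \<phi>)\<^sup>2 * sin \<theta>"
      "?c $ 3 = cos \<phi> * sin \<phi> * ((sin \<theta>)\<^sup>2 + (cos \<theta>)\<^sup>2)"
    unfolding vector_derivative_sph_point_polar vector_derivative_sph_point_azimuth cross3_def
    by (simp_all add: axis_def power2_eq_square algebra_simps del: sin_cos_squared_add3)
  moreover have "((sin \<phi>)\<^sup>2 * cos \<theta>)\<^sup>2 + ((sin \<phi>)\<^sup>2 * sin \<theta>)\<^sup>2 + (cos \<phi> * sin \<phi> * 1)\<^sup>2 = (sin \<phi>)\<^sup>2"
    using sin_cos_squared_add[of \<phi>] sin_cos_squared_add[of \<theta>] by algebra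
  ultimately have "(norm ?c)\<^sup>2 = \<bar>sin \<phi>\<bar>\<^sup>2" by simp
  then show ?thesis by (rule power2_eq_imp_eq) simp_all
qed

lemma space_area_S2: "space area_S2 = S2"
  by (simp add: area_S2_def space_restrict_space)

lemma borel_measurable_area_S2:
  "continuous_on S2 f \<Longrightarrow> f \<in> borel_measurable area_S2"
  using borel_measurable_continuous_on_restrict by (simp add: area_S2_def)

text \<open>Push-forward, density and restriction are unfolded in turn. The passage to the gauge
  integral gives access to iterated integration of continuous functions on a box.\<close>

lemma integral_area_S2:
  fixes f :: "real ^ 3 \<Rightarrow> real"
  assumes f: "continuous_on S2 f"
  shows "integral\<^sup>L area_S2 f = integral {0..pi} (\<lambda>\<phi>. integral {0..2 * pi} (\<lambda>\<theta>. f (sph_point \<phi> \<theta>) * sin \<phi>))"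
proof -
  let ?R = "{0..pi} \<times> {0..2 * pi} :: (real \<times> real) set"
  let ?T = "\<lambda>x. sph_point (fst x) (snd x)"
  have R: "?R = cbox (0, 0) (pi, 2 * pi)" by (simp add: cbox_Pair_eq)
  have contT: "continuous_on A ?T" for A by (intro continuous_intros)
  have cont: "continuous_on A (\<lambda>x. f (?T x) * sin (fst x))" for A
    using sph_point_in_S2 by (intro continuous_intros continuous_on_compose2[OF f contT]) blast
  have Rs: "?R \<inter> space lborel \<in> sets lborel" unfolding R by simp
  have area: "area_S2 = distr (density (restrict_space lborel ?R) (\<lambda>x. ennreal \<bar>sin (fst x)\<bar>)) (restrict_space borel S2) ?T"
    unfolding area_S2_def area_element_sph_point by (simp add: case_prod_unfold)
  have sin_meas: "(\<lambda>x. \<bar>sin (fst x)\<bar>) \<in> borel_measurable (restrict_space lborel ?R)"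
    by (intro measurable_restrict_space1) (simp add: borel_measurable_continuous_onI continuous_intros)
  have "?T \<in> borel_measurable borel" by (intro borel_measurable_continuous_onI contT)
  then have T: "?T \<in> measurable (restrict_space lborel ?R) (restrict_space borel S2)"
    using sph_point_in_S2 by (intro measurable_restrict_space2 measurable_restrict_space1) auto
  have fm: "f \<in> borel_measurable (restrict_space borel S2)"
    by (rule borel_measurable_continuous_on_restrict[OF f])
  have "integral\<^sup>L area_S2 f = (\<integral>x. f (?T x) \<partial>density (restrict_space lborel ?R) (\<lambda>x. ennreal \<bar>sin (fst x)\<bar>))"
    unfolding area using T by (intro integral_distr fm) simp
  also have "\<dots> = (\<integral>x. \<bar>sin (fst x)\<bar> *\<^sub>R f (?T x) \<partial>restrict_space lborel ?R)"
    using measurable_compose[OF T fm] sin_meas by (intro integral_density) auto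
  also have "\<dots> = (\<integral>x. indicator ?R x *\<^sub>R (\<bar>sin (fst x)\<bar> *\<^sub>R f (?T x)) \<partial>lborel)"
    by (rule integral_restrict_space[OF Rs])
  also have "\<dots> = (LINT x : ?R | lborel. f (?T x) * sin (fst x))"
    unfolding set_lebesgue_integral_def
    by (intro Bochner_Integration.integral_cong) (auto simp: indicator_def sin_ge_zero)
  also have "\<dots> = integral ?R (\<lambda>x. f (?T x) * sin (fst x))"
    unfolding R using borel_integrable_compact[OF compact_cbox cont]
    by (intro set_borel_integral_eq_integral) (simp add: set_integrable_def)
  also have "\<dots> = integral {0..pi} (\<lambda>\<phi>. integral {0..2 * pi} (\<lambda>\<theta>. f (sph_point \<phi> \<theta>) * sin \<phi>))"
    unfolding R by (subst integral_prod_continuous[OF cont]) simp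
  finally show ?thesis .
qed

lemma has_integral_sin:
  fixes a b :: real
  assumes "a \<le> b"
  shows "(sin has_integral (cos a - cos b)) {a..b}"
proof -
  have "(sin has_integral (- cos b - - cos a)) {a..b}"
    using assms by (intro fundamental_theorem_of_calculus)
      (auto intro!: derivative_eq_intros simp: has_real_derivative_iff_has_vector_derivative[symmetric])
  then show ?thesis by simp
qed

lemma emeasure_area_S2: "emeasure area_S2 S2 = ennreal (4 * pi)"
proof -
  have "measure area_S2 S2 = integral\<^sup>L area_S2 (\<lambda>_. 1)"
    by (simp add: space_area_S2)
  also have "\<dots> = integral {0..pi} (\<lambda>\<phi>. (2 * pi) * sin \<phi>)"
    by (subst integral_area_S2) simp_all
  also have "\<dots> = 4 * pi"
    using integral_unique[OF has_integral_sin[of 0 pi]] by simp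
  finally have m: "measure area_S2 S2 = 4 * pi" .
  \<comment> \<open>An infinite total would make \<open>measure\<close> return 0, so the value
    \<open>4 * pi\<close> proves finiteness.\<close>
  then have "emeasure area_S2 S2 \<noteq> \<infinity>" by (auto simp: measure_def)
  then show ?thesis using m by (simp add: emeasure_eq_ennreal_measure)
qed

lemma integral_sigma_S2:
  fixes f :: "real ^ 3 \<Rightarrow> real"
  assumes f: "continuous_on S2 f"
  shows "integral\<^sup>L sigma_S2 f =
    integral {0..pi} (\<lambda>\<phi>. integral {0..2 * pi} (\<lambda>\<theta>. f (sph_point \<phi> \<theta>) * sin \<phi>)) / (4 * pi)"
proof -
  have sigma: "sigma_S2 = density area_S2 (\<lambda>x. ennreal (indicator S2 x / (4 * pi)))"
    unfolding sigma_S2_def uniform_measure_def emeasure_area_S2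
    by (intro arg_cong2[where f = density] ext refl)
       (auto simp: indicator_def divide_ennreal[symmetric] ennreal_1[symmetric] simp del: ennreal_1)
  have meas: "(\<lambda>x. indicator S2 x / (4 * pi) :: real) \<in> borel_measurable area_S2"
    using sets.top[of area_S2] by (intro borel_measurable_divide borel_measurable_indicator) (auto simp: space_area_S2)
  have "integral\<^sup>L sigma_S2 f = (\<integral>x. (indicator S2 x / (4 * pi)) *\<^sub>R f x \<partial>area_S2)"
    unfolding sigma by (intro integral_density borel_measurable_area_S2[OF f] meas) simp
  also have "\<dots> = (\<integral>x. f x / (4 * pi) \<partial>area_S2)"
    by (intro Bochner_Integration.integral_cong) (auto simp: space_area_S2)
  also have "\<dots> = integral\<^sup>L area_S2 f / (4 * pi)" by simp
  finally show ?thesis by (simp only: integral_area_S2[OF f])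
qed

lemma integral_counting_S2:
  fixes f :: "real ^ 3 \<Rightarrow> real"
  assumes "finite \<omega>" "\<omega> \<subseteq> S2" "\<omega> \<noteq> {}"
  shows "integral\<^sup>L (counting_S2 \<omega>) f = (\<Sum>x\<in>\<omega>. f x) / real (card \<omega>)"
proof -
  have c: "0 < card \<omega>" using assms by (simp add: card_gt_0_iff)
  have "emeasure (count_space S2) \<omega> = ennreal (real (card \<omega>))"
    using assms by (simp add: emeasure_count_space ennreal_of_nat_eq_real_of_nat)
  then have "counting_S2 \<omega> = density (count_space S2) (\<lambda>x. ennreal (indicator \<omega> x / real (card \<omega>)))"
    unfolding counting_S2_def uniform_measure_def using c
    by (intro arg_cong2[where f = density] ext refl)
       (auto simp: indicator_def divide_ennreal[symmetric] ennreal_1[symmetric] simp del: ennreal_1)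
  then have "integral\<^sup>L (counting_S2 \<omega>) f = (\<integral>x. (indicator \<omega> x / real (card \<omega>)) *\<^sub>R f x \<partial>count_space S2)"
    by (simp only:) (intro integral_density, auto)
  also have "\<dots> = (\<Sum>x | x \<in> S2 \<and> (indicator \<omega> x / real (card \<omega>)) *\<^sub>R f x \<noteq> 0. (indicator \<omega> x / real (card \<omega>)) *\<^sub>R f x)"
    using assms(1) by (intro lebesgue_integral_count_space_finite_support) (auto elim!: rev_finite_subset)
  also have "\<dots> = (\<Sum>x\<in>\<omega>. (indicator \<omega> x / real (card \<omega>)) *\<^sub>R f x)"
    using assms by (intro sum.mono_neutral_left) auto
  also have "\<dots> = (\<Sum>x\<in>\<omega>. f x / real (card \<omega>))" by (intro sum.cong) auto
  finally show ?thesis by (simp add: sum_divide_distrib)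
qed

section \<open>Equidistribution\<close>

text \<open>Periodicity reduces the shift to some \<open>b\<close> in one period. The part of the
  shifted interval beyond \<open>2 * pi\<close> is then moved back to \<open>[0, b]\<close>.\<close>

lemma integral_periodic_shift:
  fixes g :: "real \<Rightarrow> real"
  assumes g: "continuous_on UNIV g" and per: "\<And>x n. g (x + 2 * pi * of_int n) = g x"
  shows "integral {0..2 * pi} (\<lambda>s. g (a + s)) = integral {0..2 * pi} g"
proof -
  define n where "n = \<lfloor>a / (2 * pi)\<rfloor>"
  define b where "b = a - 2 * pi * of_int n"
  have "of_int n \<le> a / (2 * pi)" "a / (2 * pi) < of_int n + 1" by (simp_all add: n_def)
  then have b: "0 \<le> b" "b \<le> 2 * pi" by (simp_all add: b_def field_simps)
  have int: "g integrable_on {x..y}" for x y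
    by (intro integrable_continuous_real continuous_on_subset[OF g]) auto
  have "integral {0..2 * pi} (\<lambda>s. g (a + s)) = integral {0..2 * pi} (g \<circ> (+) b)"
    using per[of "b + s" n for s] by (simp add: b_def algebra_simps o_def)
  also have "\<dots> = integral {b..2 * pi + b} g" by (subst integral_shift_Icc_real) simp
  also have "\<dots> = integral {b..2 * pi} g + integral {2 * pi..2 * pi + b} g"
    using b by (intro Henstock_Kurzweil_Integration.integral_combine[symmetric] int) auto
  also have "integral {2 * pi..2 * pi + b} g = integral {0..b} (g \<circ> (+) (2 * pi))"
    by (subst integral_shift_Icc_real) (simp add: add.commute)
  also have "g \<circ> (+) (2 * pi) = g" using per[of _ 1] by (simp add: o_def add.commute)
  also have "integral {b..2 * pi} g + integral {0..b} g = integral {0..2 * pi} g"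
    using b by (subst add.commute) (intro Henstock_Kurzweil_Integration.integral_combine int; simp)
  finally show ?thesis .
qed

lemma abs_integral_le:
  fixes f :: "real \<Rightarrow> real"
  assumes "a \<le> b" "f integrable_on {a..b}" "\<And>x. x \<in> {a..b} \<Longrightarrow> \<bar>f x\<bar> \<le> B"
  shows "\<bar>integral {a..b} f\<bar> \<le> B * (b - a)"
proof -
  have "0 \<le> B" using assms(1) assms(3)[of a] by fastforce
  then show ?thesis
    using has_integral_bound[of B f "integral {a..b} f" a b] assms by (auto simp: integrable_integral)
qed

text \<open>
  The cells \<open>{\<phi>. \<bar>cos \<phi> - h\<^sub>k\<bar> \<le> 1 / N}\<close> have equal measure \<open>2 / N\<close> with respect to \<open>sin \<phi> d\<phi>\<close>.
\<close>

lemma spiral_riemann_sum: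
  fixes F :: "real \<Rightarrow> real"
  assumes F: "continuous_on {0..pi} F" and "1 \<le> N"
    and close: "\<And>k \<phi>. \<lbrakk>1 \<le> k; k \<le> N; 0 \<le> \<phi>; \<phi> \<le> pi; \<bar>cos \<phi> - spiral_h N k\<bar> \<le> 1 / real N\<rbrakk>
                   \<Longrightarrow> \<bar>F \<phi> - u k\<bar> \<le> e"
  shows "\<bar>integral {0..pi} (\<lambda>\<phi>. F \<phi> * sin \<phi>) - 2 / real N * (\<Sum>k=1..N. u k)\<bar> \<le> 2 * e"
proof -
  \<comment> \<open>The cell boundaries in the polar angle, at heights halfway between consecutive
    spiral heights, with the poles at both ends.\<close>
  define c where "c n = arccos (1 - 2 * real n / real N)" for n
  have range: "-1 \<le> 1 - 2 * real n / real N" "1 - 2 * real n / real N \<le> 1" if "n \<le> N" for n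
    using that \<open>1 \<le> N\<close> by (simp_all add: field_simps)
  have c: "0 \<le> c n" "c n \<le> pi" "cos (c n) = 1 - 2 * real n / real N" if "n \<le> N" for n
    using range[OF that] arccos_bounded by (simp_all add: c_def)
  have int: "(\<lambda>\<phi>. F \<phi> * sin \<phi>) integrable_on {a..b}" if "0 \<le> a" "b \<le> pi" for a b
    using that by (intro integrable_continuous_real continuous_intros continuous_on_subset[OF F]) auto
  have "\<bar>integral {0..c n} (\<lambda>\<phi>. F \<phi> * sin \<phi>) - 2 / real N * (\<Sum>k=1..n. u k)\<bar> \<le> 2 * e / real N * real n"
    if "n \<le> N" for n
    using that
  proof (induction n)
    case 0
    then show ?case by (simp add: c_def)
  next
    case (Suc n)
    let ?k = "Suc n"
    have le: "c n \<le> c ?k" unfolding c_def using Suc.prems range[of ?k] range[of n] \<open>1 \<le> N\<close>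
      by (intro arccos_le_arccos) (auto simp: field_simps)
    have sin_int: "(sin has_integral 2 / real N) {c n..c ?k}"
      using has_integral_sin[OF le] c[of n] c[of ?k] Suc.prems by (simp add: field_simps)
    have cells: "(\<lambda>\<phi>. (F \<phi> - u ?k) * sin \<phi>) integrable_on {c n..c ?k}"
      using c[of n] c[of ?k] Suc.prems
      by (intro integrable_continuous_real continuous_intros continuous_on_subset[OF F]) auto
    have bound: "\<bar>integral {c n..c ?k} (\<lambda>\<phi>. (F \<phi> - u ?k) * sin \<phi>)\<bar> \<le> integral {c n..c ?k} (\<lambda>\<phi>. e * sin \<phi>)"
      unfolding real_norm_def[symmetric]
    proof (rule integral_norm_bound_integral[OF cells])
      show "(\<lambda>\<phi>. e * sin \<phi>) integrable_on {c n..c ?k}"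
        using has_integral_integrable[OF sin_int] by (rule integrable_on_mult_right)
      fix \<phi> assume \<phi>: "\<phi> \<in> {c n..c ?k}"
      then have \<phi>': "0 \<le> \<phi>" "\<phi> \<le> pi" using c[of n] c[of ?k] Suc.prems by auto
      have "cos (c ?k) \<le> cos \<phi>" "cos \<phi> \<le> cos (c n)"
        using \<phi> \<phi>' c(1)[of n] c(2)[of ?k] Suc.prems by (auto intro!: cos_monotone_0_pi_le)
      then have "\<bar>cos \<phi> - spiral_h N ?k\<bar> \<le> 1 / real N"
        using c[of n] c[of ?k] Suc.prems by (simp add: spiral_h_def abs_le_iff add_divide_distrib diff_divide_distrib)
      then have "\<bar>F \<phi> - u ?k\<bar> \<le> e" using close[of ?k \<phi>] Suc.prems \<phi>' by simp
      moreover have "0 \<le> sin \<phi>" using \<phi>' by (rule sin_ge_zero)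
      ultimately show "norm ((F \<phi> - u ?k) * sin \<phi>) \<le> e * sin \<phi>"
        by (simp add: abs_mult mult_right_mono)
    qed
    have "integral {c n..c ?k} (\<lambda>\<phi>. (F \<phi> - u ?k) * sin \<phi>)
        = integral {c n..c ?k} (\<lambda>\<phi>. F \<phi> * sin \<phi>) - integral {c n..c ?k} (\<lambda>\<phi>. u ?k * sin \<phi>)"
      unfolding left_diff_distrib
      using c[of n] c[of ?k] Suc.prems sin_int
      by (intro integral_diff int integrable_on_mult_right) (auto intro: has_integral_integrable)
    then have "\<bar>integral {c n..c ?k} (\<lambda>\<phi>. F \<phi> * sin \<phi>) - 2 / real N * u ?k\<bar> \<le> 2 * e / real N"
      using bound integral_unique[OF sin_int] by (simp add: mult.commute)
    moreover have "integral {0..c ?k} (\<lambda>\<phi>. F \<phi> * sin \<phi>)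
        = integral {0..c n} (\<lambda>\<phi>. F \<phi> * sin \<phi>) + integral {c n..c ?k} (\<lambda>\<phi>. F \<phi> * sin \<phi>)"
      using c[of n] c[of ?k] Suc.prems le by (intro Henstock_Kurzweil_Integration.integral_combine[symmetric] int) auto
    moreover have "2 / real N * (\<Sum>k=1..?k. u k) = 2 / real N * (\<Sum>k=1..n. u k) + 2 / real N * u ?k"
      by (simp add: distrib_left)
    moreover have "2 * e / real N * real ?k = 2 * e / real N * real n + 2 * e / real N"
      by (simp add: distrib_left add.commute)
    moreover have "\<bar>integral {0..c n} (\<lambda>\<phi>. F \<phi> * sin \<phi>) - 2 / real N * (\<Sum>k=1..n. u k)\<bar> \<le> 2 * e / real N * real n"
      using Suc by simp
    ultimately show ?case by linarith
  qed
  from this[of N] show ?thesis using \<open>1 \<le> N\<close> by (simp add: c_def)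
qed

text \<open>
  Along the spiral the azimuth sweeps a full turn while the polar angle moves by at most \<open>2 \<pi> / L\<close>,
  so rotating the spiral by \<open>s\<close> is almost the same as sliding along it, and averaging over \<open>s\<close>
  gives the integral over the sphere.
\<close>

lemma spiral_integral_close:
  fixes f :: "real ^ 3 \<Rightarrow> real"
  assumes f: "continuous_on S2 f" and M: "\<And>x. x \<in> S2 \<Longrightarrow> \<bar>f x\<bar> \<le> M"
    and uc: "\<And>x y. \<lbrakk>x \<in> S2; y \<in> S2; dist x y \<le> d\<rbrakk> \<Longrightarrow> \<bar>f x - f y\<bar> \<le> e"
    and L: "0 < L" "2 * pi / L \<le> d"
  defines "J \<equiv> integral {0..pi} (\<lambda>\<phi>. f (sph_point \<phi> (L * \<phi>)) * sin \<phi>)"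
  shows "\<bar>integral\<^sup>L sigma_S2 f - J / 2\<bar> \<le> 2 * e + 3 * M * (2 * pi / L)"
proof -
  define t where "t = 2 * pi / L"
  \<comment> \<open>The integral along the spiral rotated by the azimuth \<open>s\<close>;
    \<open>J\<close> is the case \<open>s = 0\<close>.\<close>
  define K where "K s = integral {0..pi} (\<lambda>\<phi>. f (sph_point \<phi> (L * \<phi> + s)) * sin \<phi>)" for s
  have fc: "continuous_on A (\<lambda>x. f (sph_point (a x) (b x)))"
    if "continuous_on A a" "continuous_on A b" for A :: "'b::t2_space set" and a b
    using that sph_point_in_S2 by (intro continuous_on_compose2[OF f] continuous_intros) auto
  have M0: "0 \<le> M" using M[OF sph_point_in_S2[of 0 0]] by linarith
  have e0: "0 \<le> e" using uc[of "sph_point 0 0" "sph_point 0 0"] sph_point_in_S2 L by (simp add: order_trans[rotated])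
  have t0: "0 < t" using L by (simp add: t_def)
  \<comment> \<open>The term with factor \<open>pi\<close> compares the integrands after sliding by
    \<open>r\<close>; the term \<open>2 * (M * t)\<close> pays for the two end pieces, of length at
    most \<open>t\<close> each.\<close>
  have KJ: "\<bar>K s - J\<bar> \<le> pi * (e + M * t) + 2 * (M * t)" if s: "0 \<le> s" "s \<le> 2 * pi" for s
  proof -
    define r where "r = s / L"
    define k where "k = (\<lambda>\<phi>. f (sph_point \<phi> (L * \<phi>)) * sin \<phi>)"
    have r: "0 \<le> r" "r \<le> t" "L * r = s" using s L by (simp_all add: r_def t_def divide_right_mono)
    have "continuous_on A k" for A
      unfolding k_def by (intro continuous_intros fc)
    then have kint: "k integrable_on {a..b}" for a b by (intro integrable_continuous_real)
    have kM: "\<bar>k \<phi>\<bar> \<le> M" for \<phi>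
      using mult_mono[OF M[OF sph_point_in_S2] abs_sin_le_one] M0 by (simp add: k_def abs_mult)
    have "integral {0..pi} (k \<circ> (+) r) = integral {r..pi + r} k"
      by (subst integral_shift_Icc_real) simp
    moreover have "integral {0..r} k + integral {r..pi + r} k = integral {0..pi + r} k"
      using r by (intro Henstock_Kurzweil_Integration.integral_combine kint) auto
    moreover have "integral {0..pi} k + integral {pi..pi + r} k = integral {0..pi + r} k"
      using r by (intro Henstock_Kurzweil_Integration.integral_combine kint) auto
    moreover have "\<bar>integral {0..r} k\<bar> \<le> M * (r - 0)"
      using r by (intro abs_integral_le kint kM) auto
    moreover have "\<bar>integral {pi..pi + r} k\<bar> \<le> M * (pi + r - pi)"
      using r by (intro abs_integral_le kint kM) auto
    moreover have "M * r \<le> M * t" using r M0 by (intro mult_left_mono)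
    ultimately have 1: "\<bar>integral {0..pi} (k \<circ> (+) r) - J\<bar> \<le> 2 * (M * t)"
      unfolding J_def k_def[symmetric] by (simp add: abs_le_iff)
    have "\<bar>integral {0..pi} (\<lambda>\<phi>. f (sph_point \<phi> (L * \<phi> + s)) * sin \<phi> - (k \<circ> (+) r) \<phi>)\<bar> \<le> (e + M * t) * (pi - 0)"
    proof (rule abs_integral_le)
      show "(\<lambda>\<phi>. f (sph_point \<phi> (L * \<phi> + s)) * sin \<phi> - (k \<circ> (+) r) \<phi>) integrable_on {0..pi}"
        unfolding k_def o_def by (intro integrable_continuous_real continuous_intros fc)
      fix \<phi> :: real
      have shift: "L * (r + \<phi>) = L * \<phi> + s" using r by (simp add: algebra_simps)
      define A where "A = f (sph_point \<phi> (L * \<phi> + s))"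
      define B where "B = f (sph_point (r + \<phi>) (L * \<phi> + s))"
      have "dist (sph_point \<phi> (L * \<phi> + s)) (sph_point (r + \<phi>) (L * \<phi> + s)) \<le> d"
        using sph_point_lipschitz_polar[of \<phi> "L * \<phi> + s" "r + \<phi>"] r L by (simp add: t_def)
      then have AB: "\<bar>A - B\<bar> \<le> e" unfolding A_def B_def by (intro uc sph_point_in_S2)
      have B: "\<bar>B\<bar> \<le> M" unfolding B_def by (intro M sph_point_in_S2)
      have "sin \<phi> - sin (r + \<phi>) = 2 * sin (- r / 2) * cos ((r + 2 * \<phi>) / 2)"
        by (simp add: sin_diff_sin algebra_simps)
      then have "\<bar>sin \<phi> - sin (r + \<phi>)\<bar> = 2 * \<bar>sin (r / 2)\<bar> * \<bar>cos ((r + 2 * \<phi>) / 2)\<bar>"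
        by (simp add: abs_mult)
      also have "\<dots> \<le> 2 * \<bar>r / 2\<bar> * 1"
        by (intro mult_mono) (auto intro: abs_sin_x_le_abs_x simp del: abs_divide)
      finally have "\<bar>sin \<phi> - sin (r + \<phi>)\<bar> \<le> t" using r by simp
      have "\<bar>A * sin \<phi> - B * sin (r + \<phi>)\<bar> = \<bar>(A - B) * sin \<phi> + B * (sin \<phi> - sin (r + \<phi>))\<bar>"
        by (simp add: algebra_simps)
      also have "\<dots> \<le> \<bar>A - B\<bar> * \<bar>sin \<phi>\<bar> + \<bar>B\<bar> * \<bar>sin \<phi> - sin (r + \<phi>)\<bar>"
        using abs_triangle_ineq by (simp only: abs_mult[symmetric])
      also have "\<dots> \<le> e * 1 + M * t"
        using AB B \<open>\<bar>sin \<phi> - sin (r + \<phi>)\<bar> \<le> t\<close> e0 M0 by (intro add_mono mult_mono) auto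
      finally show "\<bar>f (sph_point \<phi> (L * \<phi> + s)) * sin \<phi> - (k \<circ> (+) r) \<phi>\<bar> \<le> e + M * t"
        by (simp add: k_def shift A_def B_def)
    qed simp
    moreover have "integral {0..pi} (\<lambda>\<phi>. f (sph_point \<phi> (L * \<phi> + s)) * sin \<phi> - (k \<circ> (+) r) \<phi>)
        = K s - integral {0..pi} (k \<circ> (+) r)"
      unfolding K_def k_def o_def by (intro integral_diff integrable_continuous_real continuous_intros fc)
    ultimately show ?thesis using 1 by (simp add: mult.commute)
  qed
  have cont2: "continuous_on A (\<lambda>(\<phi>, s). f (sph_point \<phi> (L * \<phi> + s)) * sin \<phi>)" for A
    unfolding case_prod_unfold by (intro continuous_intros fc)
  have contK: "continuous_on {0..2 * pi} K"
    unfolding K_def cbox_interval[symmetric]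
    by (intro integral_continuous_on_param) (use cont2 in \<open>simp add: case_prod_unfold continuous_intros fc\<close>)
  \<comment> \<open>Swapping the integrals and using periodicity in \<open>s\<close> shows that the
    total over all rotations is the surface integral.\<close>
  have "integral {0..2 * pi} K
      = integral {0..pi} (\<lambda>\<phi>. integral {0..2 * pi} (\<lambda>s. f (sph_point \<phi> (L * \<phi> + s)) * sin \<phi>))"
    using integral_swap_continuous[OF cont2, of 0 pi 0 "2 * pi"] by (simp add: K_def[abs_def])
  also have "\<dots> = integral {0..pi} (\<lambda>\<phi>. integral {0..2 * pi} (\<lambda>s. f (sph_point \<phi> s) * sin \<phi>))"
    by (intro integral_cong integral_periodic_shift[of "\<lambda>s. f (sph_point _ s) * sin _"] continuous_intros fc)
       (simp add: sph_point_periodic)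
  finally have "integral\<^sup>L sigma_S2 f = integral {0..2 * pi} K / (4 * pi)"
    by (simp add: integral_sigma_S2[OF f])
  moreover have "\<bar>integral {0..2 * pi} (\<lambda>s. K s - J)\<bar> \<le> (pi * (e + M * t) + 2 * (M * t)) * (2 * pi - 0)"
    using KJ contK by (intro abs_integral_le integrable_continuous_real continuous_intros) auto
  moreover have "integral {0..2 * pi} (\<lambda>s. K s - J) = integral {0..2 * pi} K - 2 * pi * J"
    by (subst integral_diff) (auto intro: integrable_continuous_real contK)
  ultimately have "\<bar>4 * pi * (integral\<^sup>L sigma_S2 f - J / 2)\<bar> \<le> 2 * pi * (pi * (e + M * t) + 2 * (M * t))"
    by (simp add: algebra_simps)
  then have "2 * pi * (2 * \<bar>integral\<^sup>L sigma_S2 f - J / 2\<bar>) \<le> 2 * pi * (pi * (e + M * t) + 2 * (M * t))"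
    by (simp add: abs_mult)
  then have "2 * \<bar>integral\<^sup>L sigma_S2 f - J / 2\<bar> \<le> pi * (e + M * t) + 2 * (M * t)"
    by (simp only: mult_le_cancel_left_pos pi_gt_zero mult_pos_pos zero_less_numeral)
  also have "\<dots> \<le> 4 * (e + M * t) + 2 * (M * t)"
    using pi_less_4 e0 M0 t0 by (intro add_right_mono mult_right_mono) auto
  finally show ?thesis by (simp add: t_def[symmetric])
qed

text \<open>The spiral integral \<open>J\<close> links both sides: the point average differs from
  \<open>J / 2\<close> by at most \<open>e\<close>, and \<open>J / 2\<close> from the sphere average
  by at most \<open>3 * e\<close>.\<close>

lemma equidistributed_spiral_points: "equidistributed spiral_points"
  unfolding equidistributed_def
proof (intro conjI allI impI)
  show "config_seq spiral_points" by (rule config_seq_spiral_points)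
  fix f :: "real ^ 3 \<Rightarrow> real" assume f: "continuous_on S2 f"
  have "bounded (f ` S2)" by (intro compact_imp_bounded compact_continuous_image f compact_sphere)
  then have "\<exists>M. \<forall>x\<in>S2. \<bar>f x\<bar> \<le> M" unfolding bounded_iff by simp
  then obtain M where M: "\<And>x. x \<in> S2 \<Longrightarrow> \<bar>f x\<bar> \<le> M" by blast
  have inv_sqrt: "(\<lambda>N. c / sqrt (real N)) \<longlonglongrightarrow> 0" for c
    by (intro tendsto_divide_0[OF tendsto_const] filterlim_at_top_imp_at_infinity
          filterlim_compose[OF sqrt_at_top] filterlim_real_sequentially)
  show "(\<lambda>N. integral\<^sup>L (counting_S2 (spiral_points N)) f) \<longlonglongrightarrow> integral\<^sup>L sigma_S2 f"
  proof (rule tendstoI)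
    fix \<epsilon> :: real assume \<epsilon>: "0 < \<epsilon>"
    define e where "e = \<epsilon> / 8"
    have e: "0 < e" using \<epsilon> by (simp add: e_def)
    have "uniformly_continuous_on S2 f" by (intro compact_uniformly_continuous f compact_sphere)
    then obtain d where d: "0 < d" "\<And>x y. \<lbrakk>x \<in> S2; y \<in> S2; dist y x < d\<rbrakk> \<Longrightarrow> dist (f y) (f x) < e"
      unfolding uniformly_continuous_on_def using e by metis
    have uc: "\<bar>f x - f y\<bar> \<le> e" if "x \<in> S2" "y \<in> S2" "dist x y \<le> d / 2" for x y
      using d(2)[of y x] d(1) that by (simp add: dist_real_def)
    have ev: "\<forall>\<^sub>F N in sequentially. c / sqrt (real N) < b" if "0 < b" for b c
      using order_tendstoD(2)[OF inv_sqrt that] .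
    have "0 < d / 2" using d by simp
    show "\<forall>\<^sub>F N in sequentially. dist (integral\<^sup>L (counting_S2 (spiral_points N)) f) (integral\<^sup>L sigma_S2 f) < \<epsilon>"
      \<comment> \<open>The thresholds ensure in turn that curve and points are
        \<open>d / 2\<close>-close, that one turn moves the polar angle by at most
        \<open>d / 2\<close>, and that the error from sliding is at most \<open>e\<close>.\<close>
      using eventually_ge_at_top[of 1] ev[OF \<open>0 < d / 2\<close>, of 4]
        ev[OF \<open>0 < d / 2\<close>, of "2 * pi / sqrt pi"] ev[OF e, of "3 * M * (2 * pi / sqrt pi)"]
    proof eventually_elim
      case (elim N)
      define L where "L = sqrt (real N * pi)"
      define S where "S = (\<Sum>k=1..N. f (spiral_point N k))"
      define J where "J = integral {0..pi} (\<lambda>\<phi>. f (sph_point \<phi> (L * \<phi>)) * sin \<phi>)"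
      have L: "0 < L" "2 * pi / L \<le> d / 2" "3 * M * (2 * pi / L) \<le> e"
        using elim by (simp_all add: L_def real_sqrt_mult mult_ac)
      have "\<bar>J - 2 / real N * S\<bar> \<le> 2 * e"
        unfolding J_def S_def
      proof (rule spiral_riemann_sum[OF _ elim(1)])
        show "continuous_on {0..pi} (\<lambda>\<phi>. f (sph_point \<phi> (L * \<phi>)))"
          using sph_point_in_S2 by (intro continuous_on_compose2[OF f] continuous_intros) auto
        fix k \<phi> assume "1 \<le> k" "k \<le> N" "0 \<le> \<phi>" "\<phi> \<le> pi" "\<bar>cos \<phi> - spiral_h N k\<bar> \<le> 1 / real N"
        then have "dist (sph_point \<phi> (L * \<phi>)) (spiral_point N k) \<le> 4 / sqrt (real N)"
          unfolding L_def by (rule dist_spiral_curve)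
        then show "\<bar>f (sph_point \<phi> (L * \<phi>)) - f (spiral_point N k)\<bar> \<le> e"
          using elim(2) by (intro uc sph_point_in_S2) (auto simp: spiral_point_def sph_point_in_S2[simplified])
      qed
      moreover have "\<bar>integral\<^sup>L sigma_S2 f - J / 2\<bar> \<le> 2 * e + 3 * M * (2 * pi / L)"
        unfolding J_def by (rule spiral_integral_close[OF f M uc L(1,2)])
      moreover have "integral\<^sup>L (counting_S2 (spiral_points N)) f = S / real N"
      proof -
        have "finite (spiral_points N)" "spiral_points N \<subseteq> S2" "card (spiral_points N) = N"
          using config_seq_spiral_points elim(1) unfolding config_seq_def by auto
        moreover from this have "spiral_points N \<noteq> {}" using elim(1) by auto
        moreover have "sum f (spiral_points N) = S"
          unfolding S_def spiral_points_eq by (simp only: sum.reindex[OF inj_on_spiral_point] o_def)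
        ultimately show ?thesis by (simp add: integral_counting_S2)
      qed
      ultimately have "\<bar>S / real N - integral\<^sup>L sigma_S2 f\<bar> \<le> 4 * e"
        using L(3) by (simp add: abs_le_iff)
      then show ?case
        using e unfolding e_def dist_real_def \<open>integral\<^sup>L (counting_S2 (spiral_points N)) f = S / real N\<close> by simp
    qed
  qed
qed

theorem theorem1:
  shows "equidistributed spiral_points
    \<and> quasi_uniform spiral_points
    \<and> (\<lambda>N. sqrt (real N) * separation (spiral_points N))
        \<longlonglongrightarrow> sqrt (8 - 4 * sqrt 3 * cos (sqrt (2 * pi) * (1 - sqrt 3)))
    \<and> \<bar>sqrt (8 - 4 * sqrt 3 * cos (sqrt (2 * pi) * (1 - sqrt 3))) - 3.131948\<bar> \<le> 5 / 10 ^ 7"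
  by (intro conjI equidistributed_spiral_points quasi_uniform_spiral_points separation_tendsto separation_constant_bounds(1))

end
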